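(* Let $F_\infty$ be the free group on $X_\infty=\{x_0,x_1,\ldots\}$, fix an enumeration $F_\infty=\{w_0,w_1,\ldots\}$, and let $\mathcal{M}=\{N\subseteq F_\infty: N \trianglelefteq F_\infty\}$ with the topology inherited from $2^{F_\infty}$. Let $\mathcal{G}\subseteq \mathbb{N}^{\mathbb{N}\times\mathbb{N}}$ be the set of all group operations on $\mathbb{N}$, with the topology inherited from the product of discrete topologies; for $G\in\mathcal{G}$ write $\widetilde G=(\mathbb{N},G)$. For $m\in\mathbb{N}$ let $$\mathcal{D}_m=\{N\in\mathcal{M}:\ |F_\infty/N|\geq m \text{ and for all } i<m,\ |w_iN\cap X_\infty|\geq m\},\qquad \mathcal{D}=\bigcap_{m\in\mathbb{N}}\mathcal{D}_m.$$ Then $\mathcal{D}$ is comeager in $\mathcal{M}$, and there is a surjective, open, continuous map $f:\mathcal{D}\to\mathcal{G}$ such that $F_\infty/N\cong \widetilde{f(N)}=(\mathbb{N},f(N))$ for every $N\in\mathcal{D}$.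
   Context: $\mathbb{N}=\{0,1,2,\ldots\}$. $\mathcal{G}$ is called the space of group operations and $\mathcal{M}$ the space of marked groups. $w_iN$ denotes the coset of $w_i$ modulo $N$. *)

theory Defs
  imports "HOL-Analysis.Analysis" "HOL-Algebra.Coset"
begin

section \<open>Free groups\<close>

text \<open>A letter \<open>(x, True)\<close> stands for the generator \<open>x\<close>, and \<open>(x, False)\<close> for its inverse.
  The free group on all elements of a type is realised on the set of reduced words.\<close>

type_synonym 'a word = "('a \<times> bool) list"

definition inv_letter :: "'a \<times> bool \<Rightarrow> 'a \<times> bool" where
  "inv_letter l = (fst l, \<not> snd l)"

fun reduced_word :: "'a word \<Rightarrow> bool" where
  "reduced_word [] = True"
| "reduced_word [l] = True"
| "reduced_word (l # k # ls) = (k \<noteq> inv_letter l \<and> reduced_word (k # ls))"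

fun cons_red :: "'a \<times> bool \<Rightarrow> 'a word \<Rightarrow> 'a word" where
  "cons_red l [] = [l]"
| "cons_red l (k # ls) = (if k = inv_letter l then ls else l # k # ls)"

definition free_group :: "'a word monoid" where
  "free_group = \<lparr>carrier = {u. reduced_word u}, mult = (\<lambda>u v. foldr cons_red u v), one = []\<rparr>"

definition gen :: "'a \<Rightarrow> 'a word" where
  "gen x = [(x, True)]"

lemma inv_letter_inv_letter [simp]: "inv_letter (inv_letter l) = l"
  by (simp add: inv_letter_def)

lemma inv_letter_neq [simp]: "inv_letter l \<noteq> l" "l \<noteq> inv_letter l"
  by (auto simp: inv_letter_def prod_eq_iff)

lemma reduced_tl: "reduced_word (l # ls) \<Longrightarrow> reduced_word ls"
  by (cases ls) auto

lemma reduced_cons_red: "reduced_word u \<Longrightarrow> reduced_word (cons_red l u)"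
  by (cases u) (auto dest: reduced_tl)

lemma cons_red_reduced: "reduced_word (l # ls) \<Longrightarrow> cons_red l ls = l # ls"
  by (cases ls) auto

lemma cons_red_cancel: "reduced_word u \<Longrightarrow> cons_red l (cons_red (inv_letter l) u) = u"
  by (cases u) (auto simp: cons_red_reduced)

lemma reduced_foldr: "reduced_word v \<Longrightarrow> reduced_word (foldr cons_red u v)"
  by (induction u) (auto simp: reduced_cons_red)

lemma foldr_cons_red:
  assumes "reduced_word w"
  shows "foldr cons_red (cons_red l v) w = cons_red l (foldr cons_red v w)"
proof (cases v)
  case (Cons k ks)
  show ?thesis
    using Cons cons_red_cancel[OF reduced_foldr[OF assms, of ks], of l] by simp
qed simp

lemma foldr_cons_red_assoc:
  "reduced_word w \<Longrightarrow> foldr cons_red (foldr cons_red u v) w = foldr cons_red u (foldr cons_red v w)"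
  by (induction u) (auto simp: foldr_cons_red)

lemma foldr_cons_red_left_inverse:
  "\<exists>v. reduced_word v \<and> foldr cons_red v u = []" if "reduced_word u"
  using that
proof (induction u)
  case (Cons l ls)
  then obtain v where v: "reduced_word v" "foldr cons_red v ls = []"
    by (auto dest: reduced_tl)
  let ?v = "foldr cons_red v [inv_letter l]"
  have "foldr cons_red ?v (l # ls) = foldr cons_red v (foldr cons_red [inv_letter l] (l # ls))"
    using Cons.prems by (rule foldr_cons_red_assoc)
  also have "\<dots> = []"
    using v by simp
  finally show ?case
    using reduced_foldr[of "[inv_letter l]" v] by auto
qed (auto intro: exI[of _ "[]"])

lemma group_free_group: "group (free_group :: 'a word monoid)"
  by (rule groupI)
     (auto simp: free_group_def reduced_foldr foldr_cons_red_assoc foldr_cons_red_left_inverse)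

lemma gen_in_carrier: "gen x \<in> carrier free_group"
  by (simp add: gen_def free_group_def)

text \<open>The universal property.\<close>

lemma inv_gen: "inv\<^bsub>free_group\<^esub> (gen x) = [(x, False)]"
  by (rule group.inv_equality[OF group_free_group])
     (auto simp: free_group_def gen_def inv_letter_def)

lemma free_group_extend:
  fixes H :: "('b, 'c) monoid_scheme"
  assumes "group H" and h: "\<And>x :: 'a. h x \<in> carrier H"
  shows "\<exists>\<phi>. \<phi> \<in> hom free_group H \<and> (\<forall>x. \<phi> (gen x) = h x)"
proof -
  interpret H: group H by fact
  define e where "e l = (if snd l then h (fst l) else inv\<^bsub>H\<^esub> (h (fst l)))" for l
  define \<phi> where "\<phi> u = foldr (\<lambda>l a. e l \<otimes>\<^bsub>H\<^esub> a) u \<one>\<^bsub>H\<^esub>" for u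
  have e: "e l \<in> carrier H" "e (inv_letter l) = inv\<^bsub>H\<^esub> (e l)" for l
    using h by (auto simp: e_def inv_letter_def)
  have \<phi>: "\<phi> u \<in> carrier H" for u
    by (induction u) (auto simp: \<phi>_def e)
  have step: "\<phi> (cons_red l u) = e l \<otimes>\<^bsub>H\<^esub> \<phi> u" for l u
  proof (cases u)
    case (Cons k ks)
    have "e l \<otimes>\<^bsub>H\<^esub> (inv\<^bsub>H\<^esub> (e l) \<otimes>\<^bsub>H\<^esub> \<phi> ks) = \<phi> ks"
      using e(1)[of l] \<phi>[of ks] by (simp flip: H.m_assoc)
    then show ?thesis
      using Cons by (auto simp: \<phi>_def e)
  qed (simp add: \<phi>_def)
  have "\<phi> (foldr cons_red u v) = \<phi> u \<otimes>\<^bsub>H\<^esub> \<phi> v" for u v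
  proof (induction u)
    case Nil
    then show ?case using \<phi>[of v] by (simp add: \<phi>_def)
  next
    case (Cons l u)
    have "\<phi> (l # u) = e l \<otimes>\<^bsub>H\<^esub> \<phi> u" by (simp add: \<phi>_def)
    then show ?case
      using Cons by (simp add: step H.m_assoc e \<phi>)
  qed
  then have "\<phi> \<in> hom free_group H"
    by (auto simp: hom_def free_group_def \<phi>)
  moreover have "\<phi> (gen x) = h x" for x
    using h by (simp add: \<phi>_def gen_def e_def)
  ultimately show ?thesis by blast
qed

lemma free_group_extend_unique:
  fixes H :: "('b, 'c) monoid_scheme"
  assumes H: "group H" and hom: "\<phi> \<in> hom free_group H" "\<psi> \<in> hom free_group H"
    and eq: "\<And>x :: 'a. \<phi> (gen x) = \<psi> (gen x)" and u: "u \<in> carrier free_group"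
  shows "\<phi> u = \<psi> u"
proof -
  interpret \<phi>: group_hom free_group H \<phi>
    by (simp add: group_hom_def group_hom_axioms_def group_free_group H hom)
  interpret \<psi>: group_hom free_group H \<psi>
    by (simp add: group_hom_def group_hom_axioms_def group_free_group H hom)
  have letter: "\<phi> [l] = \<psi> [l]" for l
  proof (cases l)
    case (Pair x b)
    show ?thesis
      using eq[of x] \<phi>.hom_inv[OF gen_in_carrier[of x]] \<psi>.hom_inv[OF gen_in_carrier[of x]]
      by (cases b) (auto simp: Pair gen_def inv_gen[unfolded gen_def])
  qed
  from u have "reduced_word u" by (simp add: free_group_def)
  then show ?thesis
  proof (induction u)
    case Nil
    then show ?case
      using \<phi>.hom_one \<psi>.hom_one by (simp add: free_group_def)
  next
    case (Cons l u)
    have c: "[l] \<in> carrier free_group" "u \<in> carrier free_group"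
      using Cons.prems by (auto simp: free_group_def dest: reduced_tl)
    have lu: "l # u = [l] \<otimes>\<^bsub>free_group\<^esub> u"
      using Cons.prems by (simp add: free_group_def cons_red_reduced)
    show ?case
      unfolding lu \<phi>.hom_mult[OF c] \<psi>.hom_mult[OF c] using Cons letter
      by (auto dest: reduced_tl)
  qed
qed

abbreviation F_inf :: "nat word monoid" where
  "F_inf \<equiv> free_group"

definition X_inf :: "nat word set" where
  "X_inf = range gen"


section \<open>The space of marked groups\<close>

text \<open>The topology on the power set of \<open>A\<close> obtained by identifying a subset with its
  characteristic function in the product of copies of the discrete two-point space.\<close>

definition powerset_topology :: "'a set \<Rightarrow> 'a set topology" where
  "powerset_topology A =
     pullback_topology (Pow A) (\<lambda>N. restrict (\<lambda>a. a \<in> N) A)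
       (product_topology (\<lambda>_. discrete_topology (UNIV :: bool set)) A)"

definition marked_groups :: "nat word set set" where
  "marked_groups = {N. N \<lhd> F_inf}"

definition marked_groups_topology :: "nat word set topology" where
  "marked_groups_topology = subtopology (powerset_topology (carrier F_inf)) marked_groups"

lemma topspace_powerset_topology [simp]: "topspace (powerset_topology A) = Pow A"
  by (auto simp: powerset_topology_def topspace_pullback_topology)

lemma topspace_marked_groups_topology [simp]: "topspace marked_groups_topology = marked_groups"
proof -
  have "marked_groups \<subseteq> Pow (carrier F_inf)"
    unfolding marked_groups_def using normal_imp_subgroup subgroup.subset by blast
  then show ?thesis
    by (auto simp: marked_groups_topology_def)
qed


section \<open>The space of group operations\<close>

text \<open>The structure \<open>(\<nat>, G)\<close>. HOL-Algebra records also carry the identity element, which the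
  operation determines; if \<open>G\<close> has no identity element, the \<open>one\<close> field is
  unspecified and the structure is not a group in any case.\<close>

definition nat_structure :: "(nat \<times> nat \<Rightarrow> nat) \<Rightarrow> nat monoid" where
  "nat_structure G =
     \<lparr>carrier = UNIV, mult = (\<lambda>a b. G (a, b)),
      one = (THE e. \<forall>a. G (e, a) = a \<and> G (a, e) = a)\<rparr>"

definition group_operations :: "(nat \<times> nat \<Rightarrow> nat) set" where
  "group_operations = {G. group (nat_structure G)}"

definition group_operations_topology :: "(nat \<times> nat \<Rightarrow> nat) topology" where
  "group_operations_topology =
     subtopology (product_topology (\<lambda>_. discrete_topology (UNIV :: nat set)) UNIV) group_operations"

lemma topspace_group_operations_topology [simp]:
  "topspace group_operations_topology = group_operations"
  by (simp add: group_operations_topology_def)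

lemma group_operations_iff:
  "G \<in> group_operations \<longleftrightarrow> (\<exists>e. group \<lparr>carrier = UNIV, mult = (\<lambda>a b. G (a, b)), one = e\<rparr>)"
proof
  assume "\<exists>e. group \<lparr>carrier = UNIV, mult = (\<lambda>a b. G (a, b)), one = e\<rparr>"
  then obtain e where e: "group \<lparr>carrier = UNIV, mult = (\<lambda>a b. G (a, b)), one = e\<rparr>" ..
  interpret group "\<lparr>carrier = UNIV, mult = (\<lambda>a b. G (a, b)), one = e\<rparr>" by fact
  have "(THE e. \<forall>a. G (e, a) = a \<and> G (a, e) = a) = e"
    using l_one r_one by (intro the_equality) (auto, metis)
  with e show "G \<in> group_operations"
    by (simp add: group_operations_def nat_structure_def)
qed (auto simp: group_operations_def nat_structure_def)


section \<open>Baire category\<close>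

definition nowhere_dense_in :: "'a topology \<Rightarrow> 'a set \<Rightarrow> bool" where
  "nowhere_dense_in X A \<longleftrightarrow> A \<subseteq> topspace X \<and> X interior_of (X closure_of A) = {}"

definition meager_in :: "'a topology \<Rightarrow> 'a set \<Rightarrow> bool" where
  "meager_in X A \<longleftrightarrow> (\<exists>U :: nat \<Rightarrow> 'a set. (\<forall>n. nowhere_dense_in X (U n)) \<and> A = (\<Union>n. U n))"

definition comeager_in :: "'a topology \<Rightarrow> 'a set \<Rightarrow> bool" where
  "comeager_in X A \<longleftrightarrow> A \<subseteq> topspace X \<and> meager_in X (topspace X - A)"


section \<open>The sets \<open>\<D>\<^sub>m\<close> and \<open>\<D>\<close>\<close>

text \<open>\<open>|A| \<ge> m\<close> is expressed as \<open>{..<m} \<lesssim> A\<close>, since \<open>card\<close> is 0 on infinite sets.\<close>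

definition D_level :: "(nat \<Rightarrow> nat word) \<Rightarrow> nat \<Rightarrow> nat word set set" where
  "D_level w m =
     {N \<in> marked_groups. {..<m} \<lesssim> carrier (F_inf Mod N) \<and>
        (\<forall>i<m. {..<m} \<lesssim> (w i <#\<^bsub>F_inf\<^esub> N) \<inter> X_inf)}"

definition D_set :: "(nat \<Rightarrow> nat word) \<Rightarrow> nat word set set" where
  "D_set w = (\<Inter>m. D_level w m)"

end

theory Submission
  imports Defs "HOL-Algebra.Generated_Groups"
begin

text \<open>For \<open>N \<in> \<D>\<close> every coset contains a generator, so the cosets can be numbered in the order in
  which they first occur in \<open>x\<^sub>0 N, x\<^sub>1 N, \<dots>\<close>, and \<open>f N\<close> is the group operation transported along this
  numbering. A finite part of \<open>N\<close> determines the numbers of finitely many cosets; hence \<open>f\<close> is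
  continuous. Conversely, \<open>N\<close> is the kernel of the homomorphism \<open>F\<^sub>\<infinity> \<rightarrow> (\<nat>, f N)\<close> with \<open>x\<^sub>i \<mapsto> c i\<close>, where
  \<open>c i\<close> is the number of \<open>x\<^sub>i N\<close>. Keeping \<open>c\<close> and replacing \<open>f N\<close> by a nearby group operation \<open>G\<close> gives a
  kernel that is near \<open>N\<close>, lies in \<open>\<D>\<close> because the fibres of \<open>c\<close> are infinite, and is mapped to \<open>G\<close>
  because \<open>c\<close> numbers its own values by first occurrence. So \<open>f\<close> is open, and any such \<open>c\<close> shows
  that \<open>f\<close> is surjective. The sets \<open>\<D>\<^sub>m\<close> are open, and they are dense since finitely many conditions
  on \<open>N\<close> involve only finitely many generators.\<close>

section \<open>Numbering values by first occurrence\<close>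

text \<open>The rank of \<open>y\<close> among the distinct values of \<open>q\<close>, in order of
  appearance. It is meaningful only for \<open>y\<close> in the range of \<open>q\<close>, where the
  \<open>LEAST\<close> exists.\<close>

definition first_index :: "(nat \<Rightarrow> 'a) \<Rightarrow> 'a \<Rightarrow> nat" where
  "first_index q y = card (q ` {..<LEAST i. q i = y})"

text \<open>Both images are the quotient of \<open>A\<close> by the same equivalence relation, so
  \<open>q i\<close> \<mapsto> \<open>q' i\<close> is a well-defined bijection between them.\<close>

lemma card_image_cong_kernel:
  assumes "\<And>i j. i \<in> A \<Longrightarrow> j \<in> A \<Longrightarrow> q i = q j \<longleftrightarrow> q' i = q' j"
  shows "card (q ` A) = card (q' ` A)"
proof (rule bij_betw_same_card)
  let ?h = "q' \<circ> inv_into A q"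
  have h: "?h (q i) = q' i" if "i \<in> A" for i
    using assms[OF inv_into_into[of "q i" q A] that] that by (simp add: f_inv_into_f)
  then show "bij_betw ?h (q ` A) (q' ` A)"
    using assms by (auto simp: bij_betw_def inj_on_def image_image cong: image_cong)
qed

text \<open>Source of all locality below: up to an index \<open>k\<close> where \<open>y\<close>
  occurs, only the pattern of equalities matters, not the values. The codomains may differ, so
  cosets can be compared with cosets of another subgroup or with values of a homomorphism.\<close>

lemma first_index_cong:
  assumes "q k = y"
    and y: "\<And>i. i \<le> k \<Longrightarrow> q i = y \<longleftrightarrow> q' i = y'"
    and eq: "\<And>i j. i \<le> k \<Longrightarrow> j \<le> k \<Longrightarrow> q i = q j \<longleftrightarrow> q' i = q' j"
  shows "first_index q y = first_index q' y'"
proof -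
  define l where "l = (LEAST i. q i = y)"
  have l: "l \<le> k" "q l = y"
    unfolding l_def using \<open>q k = y\<close> by (auto intro: Least_le LeastI)
  have below: "q i \<noteq> y" if "i < l" for i
    using that not_less_Least unfolding l_def by blast
  have "(LEAST i. q' i = y') = l"
    using l y below by (intro Least_equality) (auto simp: not_less[symmetric])
  moreover have "card (q ` {..<l}) = card (q' ` {..<l})"
    using l by (intro card_image_cong_kernel eq) auto
  ultimately show ?thesis
    by (simp add: first_index_def l_def)
qed

text \<open>A value that appears earlier gets a strictly smaller number, since it is itself counted
  for every later value.\<close>

lemma first_index_inj: "inj_on (first_index q) (range q)"
proof (rule inj_onI)
  fix y z assume yz: "y \<in> range q" "z \<in> range q" "first_index q y = first_index q z"
  let ?l = "\<lambda>y. LEAST i. q i = y"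
  have least: "q (?l y) = y" if "y \<in> range q" for y
    using that by (auto intro: LeastI)
  have "card (q ` {..<?l y}) < card (q ` {..<?l z})"
    if "y \<in> range q" "?l y < ?l z" for y z
  proof (rule psubset_card_mono)
    have "y \<notin> q ` {..<?l y}" using not_less_Least by force
    moreover have "y \<in> q ` {..<?l z}" using that least by (metis imageI lessThan_iff)
    ultimately show "q ` {..<?l y} \<subset> q ` {..<?l z}" using that(2) by auto
  qed simp
  from this[of y z] this[of z y] have "?l y = ?l z"
    using yz by (cases "?l y" "?l z" rule: linorder_cases) (auto simp: first_index_def)
  then show "y = z" using least yz by metis
qed

text \<open>The number of distinct values below \<open>k\<close> is unbounded in \<open>k\<close>
  and grows by at most one per step, so it skips no \<open>n\<close>. The step that first exceeds
  \<open>n\<close> introduces the value numbered \<open>n\<close>.\<close>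

lemma first_index_surj:
  assumes "infinite (range q)"
  shows "first_index q ` range q = UNIV"
proof -
  have "\<exists>i. first_index q (q i) = n" for n
  proof -
    have "\<exists>k. card (q ` {..<k}) > n"
    proof -
      obtain T where T: "T \<subseteq> range q" "finite T" "card T = Suc n"
        using infinite_arbitrarily_large[OF assms] by metis
      then obtain I where I: "finite I" "T = q ` I"
        by (metis finite_subset_image)
      then obtain k where "I \<subseteq> {..<k}"
        using finite_nat_set_iff_bounded by auto
      then have "card T \<le> card (q ` {..<k})"
        using I by (intro card_mono) auto
      then show ?thesis using T by (auto simp: Suc_le_eq)
    qed
    then obtain k where k: "card (q ` {..<k}) > n" "\<And>j. j < k \<Longrightarrow> card (q ` {..<j}) \<le> n"
      using exists_least_iff[of "\<lambda>k. card (q ` {..<k}) > n"] by (auto simp: not_less)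
    \<comment> \<open>The least such \<open>k\<close> is positive, because no value occurs below
      index 0.\<close>
    then obtain i where i: "k = Suc i" by (cases k) auto
    have "card (q ` {..<k}) \<le> (if q i \<in> q ` {..<i} then card (q ` {..<i}) else Suc (card (q ` {..<i})))"
      by (auto simp: i lessThan_Suc card_insert_if insert_absorb)
    with k(1) k(2)[of i] i have new: "q i \<notin> q ` {..<i}" and card: "card (q ` {..<i}) = n"
      by (auto split: if_splits)
    have "(LEAST j. q j = q i) = i"
      using new by (intro Least_equality) (auto simp: image_iff not_less[symmetric], metis lessThan_iff)
    with card show ?thesis unfolding first_index_def by metis
  qed
  then show ?thesis by (auto simp: image_iff) metis
qed

section \<open>A sequence that numbers its own values and has infinite fibres\<close>

lemma infinite_prod_decode_fibre: "infinite {i. fst (prod_decode i) = a}"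
proof
  assume "finite {i. fst (prod_decode i) = a}"
  moreover have "range (\<lambda>n. prod_encode (a, n)) \<subseteq> {i. fst (prod_decode i) = a}" by auto
  ultimately have "finite (range (\<lambda>n. prod_encode (a, n)))" by (rule rev_finite_subset)
  moreover have "inj (\<lambda>n. prod_encode (a, n))" by (simp add: inj_on_def)
  ultimately show False using finite_imageD by blast
qed

text \<open>Renumbering a sequence with infinite fibres by first occurrence keeps the fibres and
  yields a fixed point of renumbering.\<close>

lemma first_index_numbering_exists:
  "\<exists>c :: nat \<Rightarrow> nat. (\<forall>a. infinite {i. c i = a}) \<and> (\<forall>i. first_index c (c i) = c i)"
proof -
  define q where "q i = fst (prod_decode i)" for i
  have "a \<in> range q" for a
    using not_finite_existsD[OF infinite_prod_decode_fibre[of a]] by (auto simp: q_def)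
  then have range: "range q = UNIV" by blast
  define c where "c i = first_index q (q i)" for i
  have c_iff: "c i = c j \<longleftrightarrow> q i = q j" for i j
    unfolding c_def by (intro inj_on_eq_iff[OF first_index_inj]) auto
  have "infinite {i. c i = a}" for a
  proof -
    have "a \<in> first_index q ` range q"
      by (subst first_index_surj) (simp_all add: range)
    then obtain j where "a = c j" by (auto simp: c_def)
    then have "{i. c i = a} = {i. q i = q j}" by (simp add: c_iff)
    then show ?thesis by (simp add: q_def infinite_prod_decode_fibre)
  qed
  moreover have "first_index c (c i) = c i" for i
  proof -
    \<comment> \<open>By \<open>c_iff\<close>, \<open>c\<close> and \<open>q\<close> have the same
      equality pattern, so they assign the same numbers.\<close>
    have "first_index c (c i) = first_index q (q i)"
      by (rule first_index_cong[of c i]) (simp_all add: c_iff)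
    then show ?thesis by (simp add: c_def[of i])
  qed
  ultimately show ?thesis by blast
qed

section \<open>Open sets and comeager sets\<close>

text \<open>Reduces openness to agreement on finitely many coordinates: a basic box restricts only
  finitely many of them, and with discrete factors these can be fixed exactly.\<close>

lemma openin_discrete_product_iff:
  "openin (product_topology (\<lambda>_. discrete_topology UNIV) I) W \<longleftrightarrow>
     W \<subseteq> extensional I \<and>
     (\<forall>x\<in>W. \<exists>P. finite P \<and> P \<subseteq> I \<and> (\<forall>y\<in>extensional I. (\<forall>p\<in>P. y p = x p) \<longrightarrow> y \<in> W))"
  (is "?L \<longleftrightarrow> ?R")
proof
  assume L: ?L
  have "\<exists>P. finite P \<and> P \<subseteq> I \<and> (\<forall>y\<in>extensional I. (\<forall>p\<in>P. y p = x p) \<longrightarrow> y \<in> W)"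
    if x: "x \<in> W" for x
  proof -
    obtain U where U: "finite {i \<in> I. U i \<noteq> UNIV}" "x \<in> Pi\<^sub>E I U" "Pi\<^sub>E I U \<subseteq> W"
      using bspec[OF L[unfolded openin_product_topology_alt] x] by auto
    have "y \<in> W" if "y \<in> extensional I" "\<forall>p\<in>{i \<in> I. U i \<noteq> UNIV}. y p = x p" for y
    proof -
      have "y i \<in> U i" if "i \<in> I" for i
      proof (cases "U i = UNIV")
        case False
        then show ?thesis
          using U(2) \<open>i \<in> I\<close> \<open>\<forall>p\<in>{i \<in> I. U i \<noteq> UNIV}. y p = x p\<close> by (auto simp: PiE_iff)
      qed simp
      then have "y \<in> Pi\<^sub>E I U" using \<open>y \<in> extensional I\<close> by (auto simp: PiE_iff)
      then show ?thesis using U by blast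
    qed
    then show ?thesis using U(1) by (intro exI[of _ "{i \<in> I. U i \<noteq> UNIV}"]) auto
  qed
  moreover have "W \<subseteq> extensional I"
    using openin_subset[OF L] by (auto simp: PiE_iff)
  ultimately show ?R by blast
next
  assume R: ?R
  show ?L
    unfolding openin_product_topology_alt
  proof
    fix x assume "x \<in> W"
    then obtain P where P: "finite P" "P \<subseteq> I"
      "\<And>y. y \<in> extensional I \<Longrightarrow> \<forall>p\<in>P. y p = x p \<Longrightarrow> y \<in> W"
      using bspec[OF conjunct2[OF R] \<open>x \<in> W\<close>] by blast
    \<comment> \<open>The smallest box around \<open>x\<close> that fixes the coordinates in
      \<open>P\<close>.\<close>
    define U where "U i = (if i \<in> P then {x i} else UNIV)" for i
    have "{i \<in> I. U i \<noteq> UNIV} \<subseteq> P" by (auto simp: U_def)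
    then have "finite {i \<in> I. U i \<noteq> UNIV}" using P(1) finite_subset by blast
    moreover have "x \<in> Pi\<^sub>E I U" using R \<open>x \<in> W\<close> by (auto simp: U_def PiE_iff)
    moreover have "Pi\<^sub>E I U \<subseteq> W"
    proof
      fix y assume y: "y \<in> Pi\<^sub>E I U"
      then show "y \<in> W"
        using P(2) by (intro P(3)) (auto simp: PiE_iff U_def subset_iff split: if_splits)
    qed
    ultimately show "\<exists>U. finite {i \<in> I. U i \<noteq> topspace (discrete_topology UNIV)} \<and>
        (\<forall>i\<in>I. openin (discrete_topology UNIV) (U i)) \<and> x \<in> Pi\<^sub>E I U \<and> Pi\<^sub>E I U \<subseteq> W"
      by auto
  qed
qed

text \<open>The previous criterion carried over along characteristic functions, which identify
  \<open>Pow A\<close> with the extensional boolean functions on \<open>A\<close>.\<close>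

lemma openin_powerset_topology_iff:
  "openin (powerset_topology A) W \<longleftrightarrow>
     W \<subseteq> Pow A \<and>
     (\<forall>N\<in>W. \<exists>S. finite S \<and> S \<subseteq> A \<and> (\<forall>N'\<subseteq>A. N' \<inter> S = N \<inter> S \<longrightarrow> N' \<in> W))"
  (is "?L \<longleftrightarrow> ?R")
proof -
  let ?h = "\<lambda>N. restrict (\<lambda>a. a \<in> N) A"
  show ?thesis
  proof
    assume ?L
    then obtain U where U: "openin (product_topology (\<lambda>_. discrete_topology UNIV) A) U"
      "W = ?h -` U \<inter> Pow A"
      by (auto simp: powerset_topology_def openin_pullback_topology)
    have "\<exists>S. finite S \<and> S \<subseteq> A \<and> (\<forall>N'\<subseteq>A. N' \<inter> S = N \<inter> S \<longrightarrow> N' \<in> W)" if N: "N \<in> W" for N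
    proof -
      have "?h N \<in> U" using N U(2) by blast
      from bspec[OF conjunct2[OF U(1)[unfolded openin_discrete_product_iff]] this] obtain S where S: "finite S" "S \<subseteq> A"
        "\<And>y. y \<in> extensional A \<Longrightarrow> \<forall>p\<in>S. y p = ?h N p \<Longrightarrow> y \<in> U"
        by blast
      have "N' \<in> W" if "N' \<subseteq> A" "N' \<inter> S = N \<inter> S" for N'
      proof -
        have "p \<in> N' \<longleftrightarrow> p \<in> N" if "p \<in> S" for p
          using that \<open>N' \<inter> S = N \<inter> S\<close> by blast
        then show ?thesis
          using that(1) S(2) unfolding U(2) by (auto intro!: S(3))
      qed
      then show ?thesis using S by blast
    qed
    moreover have "W \<subseteq> Pow A" using U(2) by blast
    ultimately show ?R by simp
  next
    assume R: ?R
    have "openin (product_topology (\<lambda>_. discrete_topology UNIV) A) (?h ` W)"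
      unfolding openin_discrete_product_iff
    proof (intro conjI ballI)
      fix x assume "x \<in> ?h ` W"
      then obtain N where N: "N \<in> W" "x = ?h N" by blast
      then obtain S where S: "finite S" "S \<subseteq> A" "\<And>N'. N' \<subseteq> A \<Longrightarrow> N' \<inter> S = N \<inter> S \<Longrightarrow> N' \<in> W"
        using bspec[OF conjunct2[OF R] N(1)] by blast
      have "y \<in> ?h ` W" if y: "y \<in> extensional A" "\<forall>p\<in>S. y p = x p" for y
      proof
        \<comment> \<open>Characteristic functions exhaust the extensional boolean functions, so
          each \<open>y\<close> near \<open>x\<close> comes from a subset.\<close>
        show "y = ?h {a \<in> A. y a}"
          using y(1) by (auto simp: fun_eq_iff extensional_def)
        show "{a \<in> A. y a} \<in> W"
          using y(2) S(2) N(2) by (intro S(3)) auto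
      qed
      then show "\<exists>P. finite P \<and> P \<subseteq> A \<and>
          (\<forall>y\<in>extensional A. (\<forall>p\<in>P. y p = x p) \<longrightarrow> y \<in> ?h ` W)"
        using S by blast
    qed auto
    \<comment> \<open>Injectivity of \<open>?h\<close> on \<open>Pow A\<close> makes
      \<open>W\<close> the full preimage of its image.\<close>
    moreover have "W = ?h -` (?h ` W) \<inter> Pow A"
    proof -
      have "N = N'" if "N \<subseteq> A" "N' \<subseteq> A" "?h N = ?h N'" for N N'
        using that by (auto simp: fun_eq_iff restrict_def split: if_splits)
      moreover have "W \<subseteq> Pow A" using R by simp
      ultimately show ?thesis by blast
    qed
    ultimately show ?L
      unfolding powerset_topology_def openin_pullback_topology by (intro exI conjI)
  qed
qed

lemma openin_subtopology_nbhd_iff: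
  "openin (subtopology X T) W \<longleftrightarrow>
     W \<subseteq> T \<and> (\<forall>x\<in>W. \<exists>V. openin X V \<and> x \<in> V \<and> V \<inter> T \<subseteq> W)"
proof
  assume "openin (subtopology X T) W"
  then show "W \<subseteq> T \<and> (\<forall>x\<in>W. \<exists>V. openin X V \<and> x \<in> V \<and> V \<inter> T \<subseteq> W)"
    by (auto simp: openin_subtopology)
next
  assume R: "W \<subseteq> T \<and> (\<forall>x\<in>W. \<exists>V. openin X V \<and> x \<in> V \<and> V \<inter> T \<subseteq> W)"
  show "openin (subtopology X T) W"
  proof (subst openin_subopen, intro ballI)
    fix x assume "x \<in> W"
    with R obtain V where "openin X V" "x \<in> V" "V \<inter> T \<subseteq> W" by blast
    then show "\<exists>V. openin (subtopology X T) V \<and> x \<in> V \<and> V \<subseteq> W"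
      using R \<open>x \<in> W\<close> by (intro exI[of _ "V \<inter> T"]) (auto simp: openin_subtopology)
  qed
qed

text \<open>Stated for arbitrary \<open>T\<close>, so that it serves both
  \<open>marked_groups\<close> and \<open>D_set w\<close>: neighbourhoods are given by traces on
  finite sets of words.\<close>

lemma openin_subtopology_powerset_iff:
  assumes "T \<subseteq> Pow A"
  shows "openin (subtopology (powerset_topology A) T) W \<longleftrightarrow>
     W \<subseteq> T \<and>
     (\<forall>N\<in>W. \<exists>S. finite S \<and> S \<subseteq> A \<and> (\<forall>N'\<in>T. N' \<inter> S = N \<inter> S \<longrightarrow> N' \<in> W))"
  (is "?L \<longleftrightarrow> ?R")
proof
  assume ?L
  then obtain V where V: "openin (powerset_topology A) V" "W = V \<inter> T"
    by (auto simp: openin_subtopology)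
  have "\<exists>S. finite S \<and> S \<subseteq> A \<and> (\<forall>N'\<in>T. N' \<inter> S = N \<inter> S \<longrightarrow> N' \<in> W)" if "N \<in> W" for N
  proof -
    have "N \<in> V" using that V(2) by blast
    from bspec[OF conjunct2[OF V(1)[unfolded openin_powerset_topology_iff]] this]
    obtain S where S: "finite S" "S \<subseteq> A" "\<And>N'. N' \<subseteq> A \<Longrightarrow> N' \<inter> S = N \<inter> S \<Longrightarrow> N' \<in> V"
      by blast
    then show ?thesis using assms V(2) by (intro exI[of _ S]) auto
  qed
  moreover have "W \<subseteq> T" using V(2) by blast
  ultimately show ?R by simp
next
  assume R: ?R
  have "\<exists>V. openin (powerset_topology A) V \<and> N \<in> V \<and> V \<inter> T \<subseteq> W" if N: "N \<in> W" for N
  proof -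
    from bspec[OF conjunct2[OF R] N]
    obtain S where "finite S \<and> S \<subseteq> A \<and> (\<forall>N'\<in>T. N' \<inter> S = N \<inter> S \<longrightarrow> N' \<in> W)" ..
    then have S: "finite S" "S \<subseteq> A" "\<And>N'. N' \<in> T \<Longrightarrow> N' \<inter> S = N \<inter> S \<Longrightarrow> N' \<in> W"
      by auto
    have "openin (powerset_topology A) {N' \<in> Pow A. N' \<inter> S = N \<inter> S}"
      using S(1,2) unfolding openin_powerset_topology_iff by (auto intro!: exI[of _ S])
    moreover have "N \<in> Pow A" using R N assms by auto
    ultimately show ?thesis
      using S(3) by (intro exI[of _ "{N' \<in> Pow A. N' \<inter> S = N \<inter> S}"]) auto
  qed
  with R show ?L unfolding openin_subtopology_nbhd_iff by simp
qed

lemma openin_group_operations_iff: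
  "openin group_operations_topology W \<longleftrightarrow>
     W \<subseteq> group_operations \<and>
     (\<forall>G\<in>W. \<exists>P. finite P \<and> (\<forall>G'\<in>group_operations. (\<forall>p\<in>P. G' p = G p) \<longrightarrow> G' \<in> W))"
  (is "?L \<longleftrightarrow> ?R")
proof
  assume ?L
  then obtain V where V: "openin (product_topology (\<lambda>_. discrete_topology UNIV) UNIV) V"
      "W = V \<inter> group_operations"
    by (auto simp: openin_subtopology group_operations_topology_def)
  have "\<exists>P. finite P \<and> (\<forall>G'\<in>group_operations. (\<forall>p\<in>P. G' p = G p) \<longrightarrow> G' \<in> W)" if "G \<in> W" for G
  proof -
    have "G \<in> V" using that V(2) by simp
    from bspec[OF conjunct2[OF V(1)[unfolded openin_discrete_product_iff]] this]
    show ?thesis unfolding V(2) by auto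
  qed
  moreover have "W \<subseteq> group_operations" using V(2) by simp
  ultimately show ?R by simp
next
  assume R: ?R
  have "\<exists>V. openin (product_topology (\<lambda>_. discrete_topology UNIV) UNIV) V \<and> G \<in> V \<and>
      V \<inter> group_operations \<subseteq> W" if G: "G \<in> W" for G
  proof -
    from bspec[OF conjunct2[OF R] G]
    obtain P where "finite P \<and> (\<forall>G'\<in>group_operations. (\<forall>p\<in>P. G' p = G p) \<longrightarrow> G' \<in> W)" ..
    then have P: "finite P" "\<And>G'. G' \<in> group_operations \<Longrightarrow> \<forall>p\<in>P. G' p = G p \<Longrightarrow> G' \<in> W"
      by auto
    have "openin (product_topology (\<lambda>_. discrete_topology UNIV) UNIV) {G'. \<forall>p\<in>P. G' p = G p}"
      using P(1) unfolding openin_discrete_product_iff by (auto intro!: exI[of _ P])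
    then show ?thesis
      using P(2) by (intro exI[of _ "{G'. \<forall>p\<in>P. G' p = G p}"]) auto
  qed
  with R show ?L
    unfolding group_operations_topology_def openin_subtopology_nbhd_iff by simp
qed

text \<open>The complement of a dense open set is closed with empty interior, and the union of these
  complements is the complement of the intersection.\<close>

lemma comeager_in_INT:
  fixes V :: "nat \<Rightarrow> 'a set"
  assumes "\<And>n. openin X (V n)" and "\<And>n. X closure_of (V n) = topspace X"
  shows "comeager_in X (\<Inter>n. V n)"
proof -
  have "nowhere_dense_in X (topspace X - V n)" for n
  proof -
    have "X closure_of (topspace X - V n) = topspace X - V n"
      using assms(1) by (simp add: closure_of_closedin closedin_diff)
    then show ?thesis
      using assms(2)[of n] by (simp add: nowhere_dense_in_def interior_of_complement)
  qed
  moreover have "topspace X - (\<Inter>n. V n) = (\<Union>n. topspace X - V n)" by blast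
  moreover have "(\<Inter>n. V n) \<subseteq> topspace X" using openin_subset[OF assms(1)[of 0]] by blast
  ultimately show ?thesis
    unfolding comeager_in_def meager_in_def
    by (auto intro!: exI[of _ "\<lambda>n. topspace X - V n"])
qed

section \<open>Homomorphisms from the free group\<close>

interpretation F: group F_inf by (rule group_free_group)

text \<open>Reducedness turns consing a letter into multiplication by it. Hence a homomorphism at
  \<open>u\<close> is determined by the finitely many generators occurring in
  \<open>u\<close>.\<close>

lemma word_in_generate:
  "reduced_word u \<Longrightarrow> u \<in> generate free_group (gen ` fst ` set u)"
proof (induction u)
  case Nil
  show ?case using generate.one[of free_group] by (simp add: free_group_def)
next
  case (Cons l u)
  obtain x b where l: "l = (x, b)" by (cases l)
  let ?X = "gen ` fst ` set (l # u)"
  have "u \<in> generate free_group (gen ` fst ` set u)"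
    using Cons reduced_tl by blast
  then have "u \<in> generate free_group ?X"
    using group.mono_generate[OF group_free_group, of "gen ` fst ` set u" ?X] by auto
  moreover have "[l] \<in> generate free_group ?X"
  proof (cases b)
    case True
    then show ?thesis by (intro generate.incl) (auto simp: l gen_def)
  next
    case False
    then have "[l] = inv\<^bsub>free_group\<^esub> (gen x)" by (simp add: l inv_gen)
    then show ?thesis using generate.inv[of "gen x" ?X free_group] by (simp add: l)
  qed
  ultimately have "[l] \<otimes>\<^bsub>free_group\<^esub> u \<in> generate free_group ?X"
    by (rule generate.eng[rotated])
  then show ?case using Cons.prems by (simp add: free_group_def cons_red_reduced)
qed

lemma hom_eq_on_generate:
  assumes "group_hom G H \<phi>" "group_hom G H \<psi>" and "X \<subseteq> carrier G"
    and "\<And>x. x \<in> X \<Longrightarrow> \<phi> x = \<psi> x" and "u \<in> generate G X"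
  shows "\<phi> u = \<psi> u"
proof -
  interpret \<phi>: group_hom G H \<phi> by fact
  interpret \<psi>: group_hom G H \<psi> by fact
  note gen_in = \<phi>.G.generate_in_carrier[OF \<open>X \<subseteq> carrier G\<close>]
  show ?thesis
    using assms(5)
  proof induction
    case (inv h)
    then show ?case using assms(3,4) \<phi>.hom_inv[of h] \<psi>.hom_inv[of h] by auto
  next
    case (eng h1 h2)
    then show ?case using gen_in by simp
  qed (use assms in auto)
qed

declare gen_in_carrier [simp]

text \<open>Evaluating a fixed word consults only finitely many entries of the multiplication table.
  Induction along the generation of \<open>u\<close> collects them; the images of the generators are
  kept fixed.\<close>

lemma hom_value_local:
  assumes "G \<in> group_operations" and \<phi>: "\<phi> \<in> hom F_inf (nat_structure G)" and u: "u \<in> carrier F_inf"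
  shows "\<exists>P. finite P \<and> (\<forall>G' \<phi>'. G' \<in> group_operations \<longrightarrow> \<phi>' \<in> hom F_inf (nat_structure G') \<longrightarrow>
    (\<forall>i. \<phi>' (gen i) = \<phi> (gen i)) \<longrightarrow> (\<forall>p\<in>P. G' p = G p) \<longrightarrow> \<phi>' u = \<phi> u)"
proof -
  have hom: "group_hom F_inf (nat_structure G) \<phi>"
    if "G \<in> group_operations" "\<phi> \<in> hom F_inf (nat_structure G)" for G \<phi>
    using that by (simp add: group_hom_def group_hom_axioms_def group_operations_def F.is_group)
  interpret \<phi>: group_hom F_inf "nat_structure G" \<phi>
    using assms by (intro hom)
  have mult [simp]: "a \<otimes>\<^bsub>nat_structure G\<^esub> b = G (a, b)" for a b G
    by (simp add: nat_structure_def)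
  have carrier [simp]: "a \<in> carrier (nat_structure G)" for a G
    by (simp add: nat_structure_def)
  \<comment> \<open>One table entry pins the identity: a group has no other idempotent, so
    \<open>G' (e, e) = e\<close> makes \<open>e\<close> the identity of \<open>G'\<close>.\<close>
  define e where "e = \<phi> \<one>\<^bsub>F_inf\<^esub>"
  have e: "G (e, e) = e"
    using \<phi>.hom_mult[of "\<one>\<^bsub>F_inf\<^esub>" "\<one>\<^bsub>F_inf\<^esub>"] by (simp add: e_def)
  have e': "\<one>\<^bsub>nat_structure G'\<^esub> = e" if "G' \<in> group_operations" "G' (e, e) = e" for G'
  proof -
    interpret G': group "nat_structure G'"
      using that by (simp add: group_operations_def)
    show ?thesis using G'.r_cancel_one[of e e] that by simp
  qed
  have "reduced_word u" using u by (simp add: free_group_def)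
  then have "u \<in> generate F_inf (gen ` fst ` set u)" by (rule word_in_generate)
  then show ?thesis
  proof induction
    case one
    have "\<phi>' \<one>\<^bsub>F_inf\<^esub> = \<phi> \<one>\<^bsub>F_inf\<^esub>"
      if "G' \<in> group_operations" "\<phi>' \<in> hom F_inf (nat_structure G')" "G' (e, e) = G (e, e)" for G' \<phi>'
      using group_hom.hom_one[OF hom[OF that(1,2)]] e' that e by (simp add: e_def)
    then show ?case by (intro exI[of _ "{(e, e)}"]) auto
  next
    case (incl h)
    then show ?case by (intro exI[of _ "{}"]) auto
  next
    case (inv h)
    then obtain i where h: "h = gen i" by blast
    let ?h' = "inv\<^bsub>F_inf\<^esub> h"
    \<comment> \<open>Once the identity is pinned, this entry certifies \<open>\<phi> ?h'\<close> as
      the inverse of \<open>\<phi> h\<close> in \<open>G'\<close> too.\<close>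
    have G: "G (\<phi> ?h', \<phi> h) = e"
      using \<phi>.hom_mult[of ?h' h] by (simp add: h gen_in_carrier e_def)
    have "\<phi>' ?h' = \<phi> ?h'"
      if "G' \<in> group_operations" "\<phi>' \<in> hom F_inf (nat_structure G')" "\<forall>i. \<phi>' (gen i) = \<phi> (gen i)"
        "G' (e, e) = G (e, e)" "G' (\<phi> ?h', \<phi> h) = G (\<phi> ?h', \<phi> h)" for G' \<phi>'
    proof -
      interpret \<phi>': group_hom F_inf "nat_structure G'" \<phi>'
        using that by (intro hom)
      have "\<phi>' ?h' = inv\<^bsub>nat_structure G'\<^esub> (\<phi> h)"
        using \<phi>'.hom_inv[of h] that(3) by (simp add: h gen_in_carrier)
      also have "\<dots> = \<phi> ?h'"
        using that e e' G by (intro \<phi>'.H.inv_equality) auto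
      finally show ?thesis .
    qed
    then show ?case by (intro exI[of _ "{(e, e), (\<phi> ?h', \<phi> h)}"]) auto
  next
    case (eng h1 h2)
    have h: "h1 \<in> carrier F_inf" "h2 \<in> carrier F_inf"
      by (auto intro: F.generate_in_carrier[OF _ eng(1)] F.generate_in_carrier[OF _ eng(2)])
    obtain P where P: "finite P" "\<And>G' \<phi>'. G' \<in> group_operations \<Longrightarrow> \<phi>' \<in> hom F_inf (nat_structure G') \<Longrightarrow>
        \<forall>i. \<phi>' (gen i) = \<phi> (gen i) \<Longrightarrow> \<forall>p\<in>P. G' p = G p \<Longrightarrow> \<phi>' h1 = \<phi> h1"
      using eng.IH(1) by auto
    obtain Q where Q: "finite Q" "\<And>G' \<phi>'. G' \<in> group_operations \<Longrightarrow> \<phi>' \<in> hom F_inf (nat_structure G') \<Longrightarrow>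
        \<forall>i. \<phi>' (gen i) = \<phi> (gen i) \<Longrightarrow> \<forall>p\<in>Q. G' p = G p \<Longrightarrow> \<phi>' h2 = \<phi> h2"
      using eng.IH(2) by auto
    have "\<phi>' (h1 \<otimes>\<^bsub>F_inf\<^esub> h2) = \<phi> (h1 \<otimes>\<^bsub>F_inf\<^esub> h2)"
      if "G' \<in> group_operations" "\<phi>' \<in> hom F_inf (nat_structure G')" "\<forall>i. \<phi>' (gen i) = \<phi> (gen i)"
        "\<forall>p\<in>insert (\<phi> h1, \<phi> h2) (P \<union> Q). G' p = G p" for G' \<phi>'
      using group_hom.hom_mult[OF hom[OF that(1,2)] h] \<phi>.hom_mult[OF h] P(2)[OF that(1-3)] Q(2)[OF that(1-3)] that(4)
      by simp
    then show ?case
      using P(1) Q(1) by (intro exI[of _ "insert (\<phi> h1, \<phi> h2) (P \<union> Q)"]) auto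
  qed
qed

section \<open>Numbering the cosets of a normal subgroup\<close>

lemma (in group) mem_l_coset_iff:
  assumes "subgroup H G" "x \<in> carrier G" "y \<in> carrier G"
  shows "y \<in> x <# H \<longleftrightarrow> inv x \<otimes> y \<in> H"
proof
  assume "y \<in> x <# H"
  then obtain h where "h \<in> H" "y = x \<otimes> h" by (auto simp: l_coset_def)
  then show "inv x \<otimes> y \<in> H"
    using assms subgroup.mem_carrier[OF assms(1)] by (simp flip: m_assoc)
qed (simp add: assms subgroup.lcos_module_rev is_group)

lemma (in group) l_coset_eq_iff:
  assumes "subgroup H G" "x \<in> carrier G" "y \<in> carrier G"
  shows "x <# H = y <# H \<longleftrightarrow> inv x \<otimes> y \<in> H"
proof
  assume "x <# H = y <# H"
  moreover have "y \<in> y <# H"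
    using assms subgroup.one_closed[OF assms(1)] by (simp add: mem_l_coset_iff)
  ultimately show "inv x \<otimes> y \<in> H"
    using assms by (simp flip: mem_l_coset_iff)
next
  assume "inv x \<otimes> y \<in> H"
  then show "x <# H = y <# H"
    using assms by (intro l_repr_independence) (simp_all add: mem_l_coset_iff)
qed

text \<open>Gives cosets of a kernel and values of the homomorphism the same equality pattern, as
  \<open>first_index_cong\<close> requires.\<close>

lemma (in group_hom) l_coset_kernel_eq_iff:
  assumes "x \<in> carrier G" "y \<in> carrier G"
  shows "x <# kernel G H h = y <# kernel G H h \<longleftrightarrow> h x = h y"
proof -
  have "inv\<^bsub>H\<^esub> h x \<otimes>\<^bsub>H\<^esub> h y = \<one>\<^bsub>H\<^esub> \<longleftrightarrow> h x = h y"
    using assms H.inv_solve_left'[of "\<one>\<^bsub>H\<^esub>" "h x" "h y"] by (simp add: eq_commute)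
  moreover have "x <# kernel G H h = y <# kernel G H h \<longleftrightarrow> inv x \<otimes> y \<in> kernel G H h"
    using assms by (intro G.l_coset_eq_iff subgroup_kernel)
  ultimately show ?thesis
    using assms by (simp add: kernel_def)
qed

lemma subgroup_marked_groups: "N \<in> marked_groups \<Longrightarrow> subgroup N F_inf"
  by (simp add: marked_groups_def normal_imp_subgroup)

text \<open>Normality reconciles the right cosets of \<open>Mod\<close> with the left cosets used in
  \<open>D_level\<close>.\<close>

lemma carrier_Mod_marked_groups:
  "N \<in> marked_groups \<Longrightarrow> carrier (F_inf Mod N) = (\<lambda>u. u <#\<^bsub>F_inf\<^esub> N) ` carrier F_inf"
  unfolding carrier_FactGroup marked_groups_def by (intro image_cong) (auto simp: normal.coset_eq)

text \<open>Meaningful when the coset of \<open>u\<close> contains a generator.\<close>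

definition coset_label :: "nat word set \<Rightarrow> nat word \<Rightarrow> nat" where
  "coset_label N u = first_index (\<lambda>i. gen i <#\<^bsub>F_inf\<^esub> N) (u <#\<^bsub>F_inf\<^esub> N)"

text \<open>\<open>coset_rep N a\<close> is meaningful only if some coset of \<open>N\<close> has number \<open>a\<close>, which holds for \<open>N \<in> \<D>\<close>.\<close>

definition coset_rep :: "nat word set \<Rightarrow> nat \<Rightarrow> nat word" where
  "coset_rep N a = (SOME u. u \<in> carrier F_inf \<and> coset_label N u = a)"

text \<open>This is the map \<open>f\<close>; \<open>coset_operation_label\<close> shows that the
  choice of representatives does not matter.\<close>

definition coset_operation :: "nat word set \<Rightarrow> nat \<times> nat \<Rightarrow> nat" where
  "coset_operation N = (\<lambda>(a, b). coset_label N (coset_rep N a \<otimes>\<^bsub>F_inf\<^esub> coset_rep N b))"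

text \<open>The number is fixed by which of \<open>u\<close>, \<open>gen 0\<close>, ...,
  \<open>gen k\<close> are congruent modulo \<open>N\<close>, that is, by which of their finitely
  many quotients lie in \<open>N\<close>.\<close>

lemma coset_label_local:
  assumes N: "N \<in> marked_groups" and u: "u \<in> carrier F_inf"
    and k: "gen k <#\<^bsub>F_inf\<^esub> N = u <#\<^bsub>F_inf\<^esub> N"
  shows "\<exists>S. finite S \<and> S \<subseteq> carrier F_inf \<and>
    (\<forall>N'\<in>marked_groups. N' \<inter> S = N \<inter> S \<longrightarrow> coset_label N' u = coset_label N u)"
proof -
  let ?A = "insert u (gen ` {..k})"
  let ?S = "(\<lambda>(a, b). inv\<^bsub>F_inf\<^esub> a \<otimes>\<^bsub>F_inf\<^esub> b) ` (?A \<times> ?A)"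
  have A: "?A \<subseteq> carrier F_inf" using u gen_in_carrier by auto
  have "coset_label N' u = coset_label N u" if N': "N' \<in> marked_groups" "N' \<inter> ?S = N \<inter> ?S" for N'
  proof -
    have "a <#\<^bsub>F_inf\<^esub> N = b <#\<^bsub>F_inf\<^esub> N \<longleftrightarrow> a <#\<^bsub>F_inf\<^esub> N' = b <#\<^bsub>F_inf\<^esub> N'"
      if ab: "a \<in> ?A" "b \<in> ?A" for a b
    proof -
      have "inv\<^bsub>F_inf\<^esub> a \<otimes>\<^bsub>F_inf\<^esub> b \<in> ?S" using ab by force
      then have "inv\<^bsub>F_inf\<^esub> a \<otimes>\<^bsub>F_inf\<^esub> b \<in> N' \<longleftrightarrow> inv\<^bsub>F_inf\<^esub> a \<otimes>\<^bsub>F_inf\<^esub> b \<in> N"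
        using N'(2) by blast
      then show ?thesis
        using subsetD[OF A ab(1)] subsetD[OF A ab(2)]
          subgroup_marked_groups[OF N] subgroup_marked_groups[OF N'(1)]
        by (simp add: F.l_coset_eq_iff)
    qed
    then show ?thesis
      unfolding coset_label_def using k by (intro first_index_cong[symmetric, of _ k]) auto
  qed
  moreover have "?S \<subseteq> carrier F_inf" using A by auto
  ultimately show ?thesis by (intro exI[of _ ?S]) auto
qed

lemma coset_label_kernel:
  assumes \<phi>: "group_hom F_inf H \<phi>" and u: "u \<in> carrier F_inf" and k: "\<phi> (gen k) = \<phi> u"
  shows "coset_label (kernel F_inf H \<phi>) u = first_index (\<lambda>i. \<phi> (gen i)) (\<phi> u)"
  unfolding coset_label_def
  using k u
  by (intro first_index_cong[of _ k]) (simp_all add: group_hom.l_coset_kernel_eq_iff[OF \<phi>])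

text \<open>These are the properties of a member of \<D> that \<open>D_setD\<close> supplies: every
  coset receives a number because it contains a generator, and every natural number is used because
  the quotient is infinite.\<close>

context
  fixes N
  assumes N: "N \<in> marked_groups" and infinite_quotient: "infinite (carrier (F_inf Mod N))"
    and gen_surj: "\<And>u. u \<in> carrier F_inf \<Longrightarrow> \<exists>i. gen i <#\<^bsub>F_inf\<^esub> N = u <#\<^bsub>F_inf\<^esub> N"
begin

interpretation N: normal N F_inf
  using N by (simp add: marked_groups_def)

lemma range_gen_cosets: "range (\<lambda>i. gen i <#\<^bsub>F_inf\<^esub> N) = carrier (F_inf Mod N)"
proof -
  have "u <#\<^bsub>F_inf\<^esub> N \<in> range (\<lambda>i. gen i <#\<^bsub>F_inf\<^esub> N)" if "u \<in> carrier F_inf" for u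
    using gen_surj[OF that] by (metis rangeI)
  then show ?thesis
    by (auto simp: carrier_Mod_marked_groups[OF N])
qed

lemma coset_label_eq_iff:
  assumes "u \<in> carrier F_inf" "v \<in> carrier F_inf"
  shows "coset_label N u = coset_label N v \<longleftrightarrow> u <#\<^bsub>F_inf\<^esub> N = v <#\<^bsub>F_inf\<^esub> N"
  unfolding coset_label_def
  using assms by (intro inj_on_eq_iff[OF first_index_inj])
    (auto simp: range_gen_cosets carrier_Mod_marked_groups[OF N])

lemma coset_label_surj: "\<exists>u\<in>carrier F_inf. coset_label N u = a"
proof -
  have "a \<in> first_index (\<lambda>i. gen i <#\<^bsub>F_inf\<^esub> N) ` range (\<lambda>i. gen i <#\<^bsub>F_inf\<^esub> N)"
    using infinite_quotient by (subst first_index_surj) (simp_all add: range_gen_cosets)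
  then obtain i where "a = coset_label N (gen i)"
    by (auto simp: coset_label_def)
  then show ?thesis by (intro bexI[of _ "gen i"]) simp_all
qed

text \<open>Words with equal labels lie in the same coset, so normality makes the coset of a product
  independent of the representatives.\<close>

lemma coset_operation_label:
  assumes "u \<in> carrier F_inf" "v \<in> carrier F_inf"
  shows "coset_operation N (coset_label N u, coset_label N v) = coset_label N (u \<otimes>\<^bsub>F_inf\<^esub> v)"
proof -
  have rep: "coset_rep N a \<in> carrier F_inf" "coset_label N (coset_rep N a) = a" for a
    using someI_ex[OF coset_label_surj[of a, unfolded Bex_def]] by (simp_all add: coset_rep_def)
  define u' v' where "u' = coset_rep N (coset_label N u)" and "v' = coset_rep N (coset_label N v)"
  have carr: "u' \<in> carrier F_inf" "v' \<in> carrier F_inf"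
    using rep by (simp_all add: u'_def v'_def)
  \<comment> \<open>Right cosets are used here because \<open>rcos_sum\<close> multiplies
    those.\<close>
  have "N #>\<^bsub>F_inf\<^esub> u' = N #>\<^bsub>F_inf\<^esub> u" "N #>\<^bsub>F_inf\<^esub> v' = N #>\<^bsub>F_inf\<^esub> v"
    using rep assms coset_label_eq_iff[of u' u] coset_label_eq_iff[of v' v] N.coset_eq
    by (simp_all add: u'_def v'_def)
  then have "N #>\<^bsub>F_inf\<^esub> (u' \<otimes>\<^bsub>F_inf\<^esub> v') = N #>\<^bsub>F_inf\<^esub> (u \<otimes>\<^bsub>F_inf\<^esub> v)"
    using N.rcos_sum assms carr by metis
  then have "coset_label N (u' \<otimes>\<^bsub>F_inf\<^esub> v') = coset_label N (u \<otimes>\<^bsub>F_inf\<^esub> v)"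
    using assms carr N.coset_eq by (simp add: coset_label_eq_iff)
  then show ?thesis by (simp add: coset_operation_def u'_def v'_def)
qed

text \<open>The group laws pass from words to labels, since labelling is onto and
  multiplicative.\<close>

lemma coset_operation_group: "coset_operation N \<in> group_operations"
  unfolding group_operations_iff
proof (intro exI groupI)
  let ?G = "\<lparr>carrier = UNIV, monoid.mult = (\<lambda>a b. coset_operation N (a, b)), one = coset_label N \<one>\<^bsub>F_inf\<^esub>\<rparr>"
  fix x y z
  obtain u v w where uvw: "u \<in> carrier F_inf" "v \<in> carrier F_inf" "w \<in> carrier F_inf"
    "x = coset_label N u" "y = coset_label N v" "z = coset_label N w"
    using coset_label_surj by metis
  show "x \<otimes>\<^bsub>?G\<^esub> y \<otimes>\<^bsub>?G\<^esub> z = x \<otimes>\<^bsub>?G\<^esub> (y \<otimes>\<^bsub>?G\<^esub> z)"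
    using uvw by (simp add: coset_operation_label F.m_assoc)
  show "\<one>\<^bsub>?G\<^esub> \<otimes>\<^bsub>?G\<^esub> x = x"
    using uvw by (simp add: coset_operation_label)
  show "\<exists>y\<in>carrier ?G. y \<otimes>\<^bsub>?G\<^esub> x = \<one>\<^bsub>?G\<^esub>"
    using uvw by (intro bexI[of _ "coset_label N (inv\<^bsub>F_inf\<^esub> u)"]) (simp_all add: coset_operation_label)
qed auto

lemma group_hom_coset_label: "group_hom F_inf (nat_structure (coset_operation N)) (coset_label N)"
  using coset_operation_group
  by (auto simp: group_hom_def group_hom_axioms_def F.is_group group_operations_def hom_def
      nat_structure_def coset_operation_label)

text \<open>Recovers \<open>N\<close> from its numbering: a word has the label of the identity
  exactly when its coset is \<open>N\<close>.\<close>

lemma kernel_coset_label: "kernel F_inf (nat_structure (coset_operation N)) (coset_label N) = N"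
proof -
  interpret group_hom F_inf "nat_structure (coset_operation N)" "coset_label N"
    by (rule group_hom_coset_label)
  have "coset_label N u = \<one>\<^bsub>nat_structure (coset_operation N)\<^esub> \<longleftrightarrow> u \<in> N" if "u \<in> carrier F_inf" for u
    using that coset_label_eq_iff[of "\<one>\<^bsub>F_inf\<^esub>" u] hom_one F.l_coset_eq_iff[OF N.subgroup_axioms, of "\<one>\<^bsub>F_inf\<^esub>" u]
    by auto
  then show ?thesis using N.subset by (auto simp: kernel_def)
qed

lemma iso_coset_operation: "F_inf Mod N \<cong> nat_structure (coset_operation N)"
proof -
  have "coset_label N ` carrier F_inf = carrier (nat_structure (coset_operation N))"
    using coset_label_surj by (auto simp: nat_structure_def image_iff) metis
  from group_hom.FactGroup_iso[OF group_hom_coset_label this]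
  show ?thesis by (simp add: kernel_coset_label)
qed

text \<open>The numbering is its own renumbering: \<open>coset_label_kernel\<close> is applied to
  the labelling, whose kernel is \<open>N\<close>.\<close>

lemma first_index_coset_label:
  "first_index (\<lambda>i. coset_label N (gen i)) (coset_label N (gen i)) = coset_label N (gen i)"
  using coset_label_kernel[OF group_hom_coset_label gen_in_carrier refl]
  by (simp add: kernel_coset_label)

end

section \<open>Membership in \<D>\<close>

text \<open>The threshold \<open>k\<close> is there because the coset of \<open>w i\<close> is
  constrained only at levels \<open>m > i\<close>.\<close>

lemma infinite_iff_lepoll: "infinite A \<longleftrightarrow> (\<forall>m\<ge>k. {..<m :: nat} \<lesssim> A)"
proof
  assume R: "\<forall>m\<ge>k. {..<m} \<lesssim> A"
  show "infinite A"
  proof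
    assume "finite A"
    moreover have "{..<max k (Suc (card A))} \<lesssim> A" using R by simp
    ultimately have "max k (Suc (card A)) \<le> card A"
      by (simp add: lepoll_iff_card_le)
    then show False by simp
  qed
qed (auto intro: finite_lepoll_infinite)

text \<open>For fixed \<open>i\<close>, the levels \<open>m > i\<close> together demand infinitely
  many generators in the coset of \<open>w i\<close>. As \<open>w\<close> is onto, the enumeration
  then drops out.\<close>

lemma D_set_iff:
  assumes "range w = carrier F_inf"
  shows "N \<in> D_set w \<longleftrightarrow> N \<in> marked_groups \<and> infinite (carrier (F_inf Mod N)) \<and>
    (\<forall>u\<in>carrier F_inf. infinite {i. gen i <#\<^bsub>F_inf\<^esub> N = u <#\<^bsub>F_inf\<^esub> N})"
proof -
  have inf: "infinite ((u <#\<^bsub>F_inf\<^esub> N) \<inter> X_inf) \<longleftrightarrow>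
      infinite {i. gen i <#\<^bsub>F_inf\<^esub> N = u <#\<^bsub>F_inf\<^esub> N}"
    if N: "N \<in> marked_groups" and u: "u \<in> carrier F_inf" for u
  proof -
    have "gen i \<in> u <#\<^bsub>F_inf\<^esub> N \<longleftrightarrow> gen i <#\<^bsub>F_inf\<^esub> N = u <#\<^bsub>F_inf\<^esub> N" for i
      using subgroup_marked_groups[OF N] u F.l_coset_eq_iff[of N u "gen i"] F.mem_l_coset_iff[of N u "gen i"]
      by auto
    then have "(u <#\<^bsub>F_inf\<^esub> N) \<inter> X_inf = gen ` {i. gen i <#\<^bsub>F_inf\<^esub> N = u <#\<^bsub>F_inf\<^esub> N}"
      by (auto simp: X_inf_def)
    moreover have "inj_on gen A" for A :: "nat set"
      by (auto simp: inj_on_def gen_def)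
    ultimately show ?thesis by (simp add: finite_image_iff)
  qed
  have "N \<in> D_set w \<longleftrightarrow> N \<in> marked_groups \<and> infinite (carrier (F_inf Mod N)) \<and>
      (\<forall>i. infinite ((w i <#\<^bsub>F_inf\<^esub> N) \<inter> X_inf))"
  proof -
    have 1: "infinite (carrier (F_inf Mod N)) \<longleftrightarrow> (\<forall>m. {..<m :: nat} \<lesssim> carrier (F_inf Mod N))"
      by (subst infinite_iff_lepoll[of _ 0]) simp
    have 2: "infinite ((w i <#\<^bsub>F_inf\<^esub> N) \<inter> X_inf) \<longleftrightarrow>
        (\<forall>m>i. {..<m} \<lesssim> (w i <#\<^bsub>F_inf\<^esub> N) \<inter> X_inf)" for i
      by (subst infinite_iff_lepoll[of _ "Suc i"]) (simp add: Suc_le_eq)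
    show ?thesis unfolding 1 2 by (simp add: D_set_def D_level_def) blast
  qed
  also have "\<dots> \<longleftrightarrow> N \<in> marked_groups \<and> infinite (carrier (F_inf Mod N)) \<and>
      (\<forall>u\<in>carrier F_inf. infinite ((u <#\<^bsub>F_inf\<^esub> N) \<inter> X_inf))"
    by (simp flip: assms)
  finally show ?thesis
    using inf by auto
qed


lemma D_setD:
  assumes "range w = carrier F_inf" and "N \<in> D_set w"
  shows "N \<in> marked_groups" "infinite (carrier (F_inf Mod N))"
    "u \<in> carrier F_inf \<Longrightarrow> \<exists>i. gen i <#\<^bsub>F_inf\<^esub> N = u <#\<^bsub>F_inf\<^esub> N"
  using assms not_finite_existsD by (auto simp: D_set_iff)

text \<open>Nonempty fibres make \<open>\<phi>\<close> onto, so the quotient is a copy of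
  \<open>H\<close>; the generators in the coset of \<open>u\<close> form the fibre over
  \<open>\<phi> u\<close>.\<close>

lemma kernel_in_D_set:
  assumes w: "range w = carrier F_inf" and \<phi>: "group_hom F_inf H \<phi>" and "infinite (carrier H)"
    and fibres: "\<And>g. g \<in> carrier H \<Longrightarrow> infinite {i. \<phi> (gen i) = g}"
  shows "kernel F_inf H \<phi> \<in> D_set w"
proof -
  interpret group_hom F_inf H \<phi> by fact
  have surj: "\<phi> ` carrier F_inf = carrier H"
  proof
    show "carrier H \<subseteq> \<phi> ` carrier F_inf"
    proof
      fix g assume "g \<in> carrier H"
      then obtain i where "\<phi> (gen i) = g"
        using fibres[of g] not_finite_existsD by auto
      then show "g \<in> \<phi> ` carrier F_inf" by (intro image_eqI[of _ _ "gen i"]) simp_all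
    qed
  qed auto
  have "bij_betw (\<lambda>X. the_elem (\<phi> ` X)) (carrier (F_inf Mod kernel F_inf H \<phi>)) (carrier H)"
    using FactGroup_iso_set[OF surj] by (simp add: iso_def)
  then have "infinite (carrier (F_inf Mod kernel F_inf H \<phi>))"
    using assms(3) bij_betw_finite by blast
  then show ?thesis
    using normal_kernel fibres
    by (simp add: D_set_iff[OF w] marked_groups_def l_coset_kernel_eq_iff)
qed

text \<open>An entry of the table involves just three labels, those of words \<open>u\<close>,
  \<open>v\<close> and their product, and each label is local.\<close>

lemma coset_operation_local:
  assumes w: "range w = carrier F_inf" and N: "N \<in> D_set w"
  shows "\<exists>S. finite S \<and> S \<subseteq> carrier F_inf \<and>
    (\<forall>N'\<in>D_set w. N' \<inter> S = N \<inter> S \<longrightarrow> coset_operation N' p = coset_operation N p)"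
proof -
  have local: "\<exists>S. finite S \<and> S \<subseteq> carrier F_inf \<and>
      (\<forall>N'\<in>marked_groups. N' \<inter> S = N \<inter> S \<longrightarrow> coset_label N' u = coset_label N u)"
    if u: "u \<in> carrier F_inf" for u
  proof -
    from D_setD(3)[OF w N u] obtain k where "gen k <#\<^bsub>F_inf\<^esub> N = u <#\<^bsub>F_inf\<^esub> N" ..
    from coset_label_local[OF D_setD(1)[OF w N] u this] show ?thesis .
  qed
  obtain a b where p: "p = (a, b)" by (cases p)
  obtain u v where u: "u \<in> carrier F_inf" "coset_label N u = a" and v: "v \<in> carrier F_inf" "coset_label N v = b"
    using coset_label_surj[OF D_setD[OF w N]] by metis
  let ?uv = "u \<otimes>\<^bsub>F_inf\<^esub> v"
  have uv: "?uv \<in> carrier F_inf" using u v by simp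
  from local[OF u(1)] obtain S1 where S1: "finite S1 \<and> S1 \<subseteq> carrier F_inf \<and>
      (\<forall>N'\<in>marked_groups. N' \<inter> S1 = N \<inter> S1 \<longrightarrow> coset_label N' u = coset_label N u)" ..
  from local[OF v(1)] obtain S2 where S2: "finite S2 \<and> S2 \<subseteq> carrier F_inf \<and>
      (\<forall>N'\<in>marked_groups. N' \<inter> S2 = N \<inter> S2 \<longrightarrow> coset_label N' v = coset_label N v)" ..
  from local[OF uv] obtain S3 where S3: "finite S3 \<and> S3 \<subseteq> carrier F_inf \<and>
      (\<forall>N'\<in>marked_groups. N' \<inter> S3 = N \<inter> S3 \<longrightarrow> coset_label N' ?uv = coset_label N ?uv)" ..
  have "coset_operation N' p = coset_operation N p"
    if N': "N' \<in> D_set w" and eq: "N' \<inter> (S1 \<union> S2 \<union> S3) = N \<inter> (S1 \<union> S2 \<union> S3)" for N'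
  proof -
    have "N' \<inter> S1 = N \<inter> S1" "N' \<inter> S2 = N \<inter> S2" "N' \<inter> S3 = N \<inter> S3" using eq by blast+
    then have "coset_label N' u = coset_label N u" "coset_label N' v = coset_label N v"
      "coset_label N' ?uv = coset_label N ?uv"
      using S1 S2 S3 D_setD(1)[OF w N'] by auto
    moreover have "coset_operation M (coset_label M u, coset_label M v) = coset_label M ?uv"
      if M: "M \<in> D_set w" for M
      using coset_operation_label[OF D_setD[OF w M] u(1) v(1)] .
    from this[OF N'] this[OF N] have
      "coset_operation N' (coset_label N' u, coset_label N' v) = coset_label N' ?uv"
      "coset_operation N (coset_label N u, coset_label N v) = coset_label N ?uv" .
    ultimately show ?thesis
      using u(2) v(2) by (simp add: p)
  qed
  then show ?thesis
    using S1 S2 S3 by (intro exI[of _ "S1 \<union> S2 \<union> S3"]) auto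
qed

text \<open>By \<open>index\<close>, the label of a word modulo the kernel is its value under
  \<open>\<phi>\<close>, so the transported operation is \<open>G\<close> itself. Both openness and
  surjectivity rest on this.\<close>

lemma coset_operation_kernel:
  assumes w: "range w = carrier F_inf" and G: "G \<in> group_operations"
    and \<phi>: "\<phi> \<in> hom F_inf (nat_structure G)"
    and fibres: "\<And>a. infinite {i. \<phi> (gen i) = a}"
    and index: "\<And>i. first_index (\<lambda>i. \<phi> (gen i)) (\<phi> (gen i)) = \<phi> (gen i)"
  shows "kernel F_inf (nat_structure G) \<phi> \<in> D_set w"
    and "coset_operation (kernel F_inf (nat_structure G) \<phi>) = G"
proof -
  have hom: "group_hom F_inf (nat_structure G) \<phi>"
    using G \<phi> by (simp add: group_hom_def group_hom_axioms_def group_operations_def F.is_group)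
  then interpret group_hom F_inf "nat_structure G" \<phi> .
  let ?N = "kernel F_inf (nat_structure G) \<phi>"
  show D: "?N \<in> D_set w"
    using w hom fibres by (intro kernel_in_D_set) (simp_all add: nat_structure_def)
  have ex: "\<exists>i. \<phi> (gen i) = a" for a
    using fibres[of a] not_finite_existsD by auto
  have label: "coset_label ?N u = \<phi> u" if u: "u \<in> carrier F_inf" for u
  proof -
    obtain k where k: "\<phi> (gen k) = \<phi> u" using ex by blast
    show ?thesis
      using coset_label_kernel[OF hom u k] index[of k] by (simp add: k)
  qed
  show "coset_operation ?N = G"
  proof
    fix p :: "nat \<times> nat"
    obtain a b where p: "p = (a, b)" by (cases p)
    obtain i j where ij: "\<phi> (gen i) = a" "\<phi> (gen j) = b" using ex by metis
    have "coset_operation ?N (coset_label ?N (gen i), coset_label ?N (gen j)) =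
        coset_label ?N (gen i \<otimes>\<^bsub>F_inf\<^esub> gen j)"
      by (intro coset_operation_label D_setD[OF w D]) simp_all
    then show "coset_operation ?N p = G p"
      using ij by (simp add: label p) (simp add: nat_structure_def)
  qed
qed

section \<open>Comeagerness of \<open>\<D>\<close>\<close>

text \<open>Only finitely many generators occur in \<open>S\<close>. Sending these to \<open>F / N \<times> 1\<close> in \<open>F / N \<times> F\<close> keeps
  the trace on \<open>S\<close>, while the other generators are free to hit each element infinitely often.\<close>

lemma D_set_dense:
  assumes w: "range w = carrier F_inf" and N: "N \<in> marked_groups"
    and S: "finite S" "S \<subseteq> carrier F_inf"
  shows "\<exists>N'\<in>D_set w. N' \<inter> S = N \<inter> S"
proof -
  interpret N: normal N F_inf
    using N by (simp add: marked_groups_def)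
  let ?H = "(F_inf Mod N) \<times>\<times> F_inf"
  have H: "group ?H"
    by (intro DirProd_group N.factorgroup_is_group F.is_group)
  have carrier: "carrier (F_inf Mod N) = (\<lambda>u. N #>\<^bsub>F_inf\<^esub> u) ` carrier F_inf"
    by (rule carrier_FactGroup)
  define \<psi> where "\<psi> u = (N #>\<^bsub>F_inf\<^esub> u, \<one>\<^bsub>F_inf\<^esub>)" for u
  have \<psi>: "\<psi> \<in> hom F_inf ?H"
    using N.r_coset_hom_Mod by (auto simp: \<psi>_def hom_def)
  obtain k where k: "fst ` (\<Union>u\<in>S. set u) \<subseteq> {..<k}"
    using S(1) finite_nat_iff_bounded by blast
  \<comment> \<open>The inner decoding repeats every code infinitely often and the outer one reads
    it as a pair, so \<open>t\<close> takes each pair of indices infinitely often.\<close>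
  define t where "t i = prod_decode (fst (prod_decode i))" for i
  define h where "h i = (if i < k then \<psi> (gen i) else (N #>\<^bsub>F_inf\<^esub> w (fst (t i)), w (snd (t i))))" for i
  have w': "w i \<in> carrier F_inf" for i using w by blast
  have "h i \<in> carrier ?H" for i
    using w' by (auto simp: h_def \<psi>_def carrier)
  from free_group_extend[of ?H h, OF H this] obtain \<phi> where \<phi>: "\<phi> \<in> hom F_inf ?H" "\<And>i. \<phi> (gen i) = h i"
    by blast
  have hom: "group_hom F_inf ?H \<phi>" "group_hom F_inf ?H \<psi>"
    using H \<phi> \<psi> F.is_group by (simp_all add: group_hom_def group_hom_axioms_def)
  have "infinite (carrier F_inf)"
  proof
    assume "finite (carrier F_inf)"
    moreover have "range gen \<subseteq> carrier F_inf" by auto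
    ultimately have "finite (range (gen :: nat \<Rightarrow> nat word))" by (rule rev_finite_subset)
    moreover have "inj (gen :: nat \<Rightarrow> nat word)" by (simp add: inj_on_def gen_def)
    ultimately show False using finite_imageD by blast
  qed
  \<comment> \<open>The factor \<open>F_inf\<close> makes the target infinite even when
    \<open>N\<close> has finite index.\<close>
  then have "infinite (carrier ?H)"
    using finite_cartesian_productD2[of "carrier (F_inf Mod N)" "carrier F_inf"] by (auto simp: carrier)
  moreover have "infinite {i. \<phi> (gen i) = g}" if g: "g \<in> carrier ?H" for g
  proof -
    obtain u v where "u \<in> carrier F_inf" "v \<in> carrier F_inf" "g = (N #>\<^bsub>F_inf\<^esub> u, v)"
      using g by (auto simp: carrier)
    moreover then obtain a b where "u = w a" "v = w b" using w by (metis imageE)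
    ultimately have g: "g = (N #>\<^bsub>F_inf\<^esub> w a, w b)" by simp
    \<comment> \<open>Discarding the \<open>k\<close> reserved generators leaves the fibre
      infinite.\<close>
    have "infinite ({i. fst (prod_decode i) = prod_encode (a, b)} - {..<k})"
      using infinite_prod_decode_fibre by (rule Diff_infinite_finite[rotated]) simp
    moreover have "{i. fst (prod_decode i) = prod_encode (a, b)} - {..<k} \<subseteq> {i. \<phi> (gen i) = g}"
      by (auto simp: \<phi>(2) h_def t_def g)
    ultimately show ?thesis using infinite_super by blast
  qed
  ultimately have D: "kernel F_inf ?H \<phi> \<in> D_set w"
    using hom(1) w by (intro kernel_in_D_set)
  have "u \<in> kernel F_inf ?H \<phi> \<longleftrightarrow> u \<in> N" if u: "u \<in> S" for u
  proof -
    have uc: "u \<in> carrier F_inf" using u S by blast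
    then have "reduced_word u" by (simp add: free_group_def)
    then have "u \<in> generate F_inf (gen ` fst ` set u)" by (rule word_in_generate)
    moreover have "generate F_inf (gen ` fst ` set u) \<subseteq> generate F_inf (gen ` {..<k})"
      using k u by (intro F.mono_generate image_mono) auto
    ultimately have "u \<in> generate F_inf (gen ` {..<k})" by blast
    then have "\<phi> u = \<psi> u"
      by (rule hom_eq_on_generate[OF hom, rotated 2]) (auto simp: \<phi>(2) h_def)
    moreover have "N #>\<^bsub>F_inf\<^esub> u = N \<longleftrightarrow> u \<in> N"
      using uc N.subgroup_axioms F.coset_join1[of N u] F.coset_join2[of u N] N.subset by blast
    ultimately show ?thesis
      using uc by (simp add: kernel_def \<psi>_def)
  qed
  then have "kernel F_inf ?H \<phi> \<inter> S = N \<inter> S" by blast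
  with D show ?thesis by blast
qed

lemma marked_groups_subset_Pow: "marked_groups \<subseteq> Pow (carrier F_inf)"
  using subgroup_marked_groups subgroup.subset by blast

text \<open>Membership has finitely many witnesses: \<open>m\<close> words in distinct cosets, and
  \<open>m\<close> generators in each of \<open>m\<close> cosets. Finitely many words tested against
  \<open>N\<close> confirm them.\<close>

lemma openin_D_level:
  assumes w: "range w = carrier F_inf"
  shows "openin marked_groups_topology (D_level w m)"
  unfolding marked_groups_topology_def openin_subtopology_powerset_iff[OF marked_groups_subset_Pow]
proof (intro conjI ballI)
  show "D_level w m \<subseteq> marked_groups" by (auto simp: D_level_def)
next
  fix N assume D: "N \<in> D_level w m"
  then have N: "N \<in> marked_groups" by (simp add: D_level_def)
  have w': "w i \<in> carrier F_inf" for i using w by blast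
  note iff = F.l_coset_eq_iff[OF subgroup_marked_groups] F.mem_l_coset_iff[OF subgroup_marked_groups]
  from D have "{..<m} \<lesssim> carrier (F_inf Mod N)" by (simp add: D_level_def)
  then obtain c where c: "inj_on c {..<m}" "c \<in> {..<m} \<rightarrow> (\<lambda>u. u <#\<^bsub>F_inf\<^esub> N) ` carrier F_inf"
    by (auto simp: lepoll_def' carrier_Mod_marked_groups[OF N])
  from c(2) have "\<forall>a\<in>{..<m}. \<exists>u. u \<in> carrier F_inf \<and> c a = u <#\<^bsub>F_inf\<^esub> N" by blast
  then obtain r where r: "\<And>a. a < m \<Longrightarrow> r a \<in> carrier F_inf" "\<And>a. a < m \<Longrightarrow> c a = r a <#\<^bsub>F_inf\<^esub> N"
    by (auto dest!: bchoice)
  from D have "\<forall>i\<in>{..<m}. \<exists>g. inj_on g {..<m} \<and> g \<in> {..<m} \<rightarrow> (w i <#\<^bsub>F_inf\<^esub> N) \<inter> X_inf"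
    by (simp add: D_level_def lepoll_def')
  from bchoice[OF this] obtain g where
    g: "\<And>i. i < m \<Longrightarrow> inj_on (g i) {..<m}" "\<And>i j. i < m \<Longrightarrow> j < m \<Longrightarrow> g i j \<in> w i <#\<^bsub>F_inf\<^esub> N"
      "\<And>i j. i < m \<Longrightarrow> j < m \<Longrightarrow> g i j \<in> X_inf"
    by (auto simp: Pi_iff)
  have g': "g i j \<in> carrier F_inf" if "i < m" "j < m" for i j
    using g(3)[OF that] by (auto simp: X_inf_def)
  \<comment> \<open>The first half keeps the cosets of the \<open>r a\<close> distinct; the second
    keeps each \<open>g i j\<close> in the coset of \<open>w i\<close>.\<close>
  let ?S = "(\<lambda>(a, b). inv\<^bsub>F_inf\<^esub> (r a) \<otimes>\<^bsub>F_inf\<^esub> r b) ` ({..<m} \<times> {..<m}) \<union>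
    (\<lambda>(i, j). inv\<^bsub>F_inf\<^esub> (w i) \<otimes>\<^bsub>F_inf\<^esub> g i j) ` ({..<m} \<times> {..<m})"
  have "N' \<in> D_level w m" if N': "N' \<in> marked_groups" and eq: "N' \<inter> ?S = N \<inter> ?S" for N'
  proof -
    have "r a <#\<^bsub>F_inf\<^esub> N' = r b <#\<^bsub>F_inf\<^esub> N' \<longleftrightarrow> r a <#\<^bsub>F_inf\<^esub> N = r b <#\<^bsub>F_inf\<^esub> N"
      if ab: "a < m" "b < m" for a b
    proof -
      have "inv\<^bsub>F_inf\<^esub> (r a) \<otimes>\<^bsub>F_inf\<^esub> r b \<in> ?S" using ab by force
      then have "inv\<^bsub>F_inf\<^esub> (r a) \<otimes>\<^bsub>F_inf\<^esub> r b \<in> N' \<longleftrightarrow> inv\<^bsub>F_inf\<^esub> (r a) \<otimes>\<^bsub>F_inf\<^esub> r b \<in> N"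
        using eq by blast
      then show ?thesis using N N' r(1)[OF ab(1)] r(1)[OF ab(2)] by (simp add: iff)
    qed
    then have "inj_on (\<lambda>a. r a <#\<^bsub>F_inf\<^esub> N') {..<m}"
      using c(1) r(2) by (simp add: inj_on_def)
    moreover have "(\<lambda>a. r a <#\<^bsub>F_inf\<^esub> N') ` {..<m} \<subseteq> carrier (F_inf Mod N')"
      using r(1) by (auto simp: carrier_Mod_marked_groups[OF N'])
    ultimately have 1: "{..<m} \<lesssim> carrier (F_inf Mod N')"
      unfolding lepoll_def by blast
    have "g i j \<in> w i <#\<^bsub>F_inf\<^esub> N'" if ij: "i < m" "j < m" for i j
    proof -
      have "inv\<^bsub>F_inf\<^esub> (w i) \<otimes>\<^bsub>F_inf\<^esub> g i j \<in> ?S" using ij by force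
      then have "inv\<^bsub>F_inf\<^esub> (w i) \<otimes>\<^bsub>F_inf\<^esub> g i j \<in> N' \<longleftrightarrow> inv\<^bsub>F_inf\<^esub> (w i) \<otimes>\<^bsub>F_inf\<^esub> g i j \<in> N"
        using eq by blast
      then show ?thesis using N N' w' g'[OF ij] g(2)[OF ij] by (simp add: iff)
    qed
    then have "g i ` {..<m} \<subseteq> (w i <#\<^bsub>F_inf\<^esub> N') \<inter> X_inf" if "i < m" for i
      using that g(3) by auto
    then have 2: "{..<m} \<lesssim> (w i <#\<^bsub>F_inf\<^esub> N') \<inter> X_inf" if "i < m" for i
      using that g(1) unfolding lepoll_def by blast
    show ?thesis using N' 1 2 by (simp add: D_level_def)
  qed
  moreover have "?S \<subseteq> carrier F_inf" using r(1) w' g' by auto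
  ultimately show "\<exists>S. finite S \<and> S \<subseteq> carrier F_inf \<and>
      (\<forall>N'\<in>marked_groups. N' \<inter> S = N \<inter> S \<longrightarrow> N' \<in> D_level w m)"
    by (intro exI[of _ ?S]) auto
qed

text \<open>Each level is dense because it contains \<open>D_set w\<close>, which meets every
  nonempty open set by \<open>D_set_dense\<close>.\<close>

lemma comeager_D_set:
  assumes w: "range w = carrier F_inf"
  shows "comeager_in marked_groups_topology (D_set w)"
  unfolding D_set_def
proof (rule comeager_in_INT)
  fix m
  show "openin marked_groups_topology (D_level w m)"
    by (rule openin_D_level[OF w])
  have "D_level w m \<inter> T \<noteq> {}" if T: "openin marked_groups_topology T" "T \<noteq> {}" for T
  proof -
    note * = T(1)[unfolded marked_groups_topology_def openin_subtopology_powerset_iff[OF marked_groups_subset_Pow]]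
    obtain N where N: "N \<in> T" using T by blast
    from bspec[OF conjunct2[OF *] N] obtain S where S: "finite S \<and> S \<subseteq> carrier F_inf \<and>
      (\<forall>N'\<in>marked_groups. N' \<inter> S = N \<inter> S \<longrightarrow> N' \<in> T)" ..
    have "N \<in> marked_groups" using * N by blast
    from D_set_dense[OF w this conjunct1[OF S] conjunct1[OF conjunct2[OF S]]]
    obtain N' where N': "N' \<in> D_set w" "N' \<inter> S = N \<inter> S" ..
    then have "N' \<in> T" using S D_setD(1)[OF w N'(1)] by simp
    moreover have "N' \<in> D_level w m" using N' by (simp add: D_set_def)
    ultimately show ?thesis by blast
  qed
  then show "marked_groups_topology closure_of D_level w m = topspace marked_groups_topology"
    unfolding dense_intersects_open by simp
qed

section \<open>The map from \<open>\<D>\<close> to the group operations\<close>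

lemma openin_D_set_iff:
  assumes w: "range w = carrier F_inf"
  shows "openin (subtopology marked_groups_topology (D_set w)) W \<longleftrightarrow>
    W \<subseteq> D_set w \<and> (\<forall>N\<in>W. \<exists>S. finite S \<and> S \<subseteq> carrier F_inf \<and>
      (\<forall>N'\<in>D_set w. N' \<inter> S = N \<inter> S \<longrightarrow> N' \<in> W))"
proof -
  have sub: "D_set w \<subseteq> marked_groups" using D_setD(1)[OF w] by blast
  have "subtopology marked_groups_topology (D_set w) = subtopology (powerset_topology (carrier F_inf)) (D_set w)"
    using sub by (simp add: marked_groups_topology_def subtopology_subtopology inf.absorb2)
  moreover have "D_set w \<subseteq> Pow (carrier F_inf)"
    using sub marked_groups_subset_Pow by (rule subset_trans)
  ultimately show ?thesis
    by (simp only: openin_subtopology_powerset_iff)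
qed

lemma topspace_D_set:
  assumes "range w = carrier F_inf"
  shows "topspace (subtopology marked_groups_topology (D_set w)) = D_set w"
  using D_setD(1)[OF assms] by auto

text \<open>A neighbourhood of \<open>coset_operation N\<close> fixes finitely many table entries
  \<open>p\<close>; the union of the finite sets of words controlling them defines the neighbourhood
  of \<open>N\<close>.\<close>

lemma continuous_map_coset_operation:
  assumes w: "range w = carrier F_inf"
  shows "continuous_map (subtopology marked_groups_topology (D_set w)) group_operations_topology coset_operation"
  unfolding continuous_map topspace_D_set[OF w] topspace_group_operations_topology
proof (intro conjI allI impI)
  have group: "coset_operation N \<in> group_operations" if "N \<in> D_set w" for N
    using that by (intro coset_operation_group D_setD[OF w])
  then show "coset_operation ` D_set w \<subseteq> group_operations" by blast
  fix U assume U: "openin group_operations_topology U"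
  have "\<exists>S. finite S \<and> S \<subseteq> carrier F_inf \<and>
      (\<forall>N'\<in>D_set w. N' \<inter> S = N \<inter> S \<longrightarrow> N' \<in> {N \<in> D_set w. coset_operation N \<in> U})"
    if N: "N \<in> D_set w" "coset_operation N \<in> U" for N
  proof -
    from bspec[OF conjunct2[OF U[unfolded openin_group_operations_iff]] N(2)]
    obtain P where P: "finite P \<and>
      (\<forall>G'\<in>group_operations. (\<forall>p\<in>P. G' p = coset_operation N p) \<longrightarrow> G' \<in> U)" ..
    from coset_operation_local[OF w N(1)] obtain S where S: "\<And>p. finite (S p) \<and> S p \<subseteq> carrier F_inf \<and>
      (\<forall>N'\<in>D_set w. N' \<inter> S p = N \<inter> S p \<longrightarrow> coset_operation N' p = coset_operation N p)"
      by metis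
    have "coset_operation N' \<in> U" if N': "N' \<in> D_set w" "N' \<inter> (\<Union>p\<in>P. S p) = N \<inter> (\<Union>p\<in>P. S p)" for N'
    proof -
      have "coset_operation N' p = coset_operation N p" if "p \<in> P" for p
      proof -
        have "N' \<inter> S p = N \<inter> S p" using N'(2) that by blast
        then show ?thesis using S N'(1) by blast
      qed
      then show ?thesis using P group[OF N'(1)] by blast
    qed
    then show ?thesis
      using P S by (intro exI[of _ "\<Union>p\<in>P. S p"]) auto
  qed
  then show "openin (subtopology marked_groups_topology (D_set w)) {N \<in> D_set w. coset_operation N \<in> U}"
    unfolding openin_D_set_iff[OF w] by simp
qed

text \<open>If \<open>G'\<close> agrees with \<open>G\<close> on the finitely many entries used to
  evaluate the words in \<open>S\<close> and the identity, both kernels have the same trace on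
  \<open>S\<close>, so the new kernel stays in \<open>W\<close>.\<close>

lemma open_map_coset_operation:
  assumes w: "range w = carrier F_inf"
  shows "open_map (subtopology marked_groups_topology (D_set w)) group_operations_topology coset_operation"
  unfolding open_map_def openin_group_operations_iff
proof (intro allI impI conjI ballI)
  fix W assume W: "openin (subtopology marked_groups_topology (D_set w)) W"
  have WD: "W \<subseteq> D_set w" using W unfolding openin_D_set_iff[OF w] by (rule conjunct1)
  then show "coset_operation ` W \<subseteq> group_operations"
    by (auto intro!: coset_operation_group D_setD[OF w])
  fix G assume "G \<in> coset_operation ` W"
  then obtain N where N: "N \<in> W" "G = coset_operation N" by blast
  then have D: "N \<in> D_set w" using WD by blast
  from bspec[OF conjunct2[OF W[unfolded openin_D_set_iff[OF w]]] N(1)]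
  obtain S where S: "finite S \<and> S \<subseteq> carrier F_inf \<and> (\<forall>N'\<in>D_set w. N' \<inter> S = N \<inter> S \<longrightarrow> N' \<in> W)" ..
  let ?\<phi> = "coset_label N"
  interpret group_hom F_inf "nat_structure G" ?\<phi>
    unfolding N(2) by (intro group_hom_coset_label D_setD[OF w D])
  have G: "G \<in> group_operations"
    unfolding N(2) by (intro coset_operation_group D_setD[OF w D])
  have kernel: "kernel F_inf (nat_structure G) ?\<phi> = N"
    unfolding N(2) by (intro kernel_coset_label D_setD[OF w D])
  have infinite: "infinite {i. ?\<phi> (gen i) = a}" for a
  proof -
    obtain u where u: "u \<in> carrier F_inf" "?\<phi> u = a"
      using coset_label_surj[OF D_setD[OF w D]] by blast
    then have "infinite {i. gen i <#\<^bsub>F_inf\<^esub> N = u <#\<^bsub>F_inf\<^esub> N}"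
      using D by (simp add: D_set_iff[OF w])
    moreover have "?\<phi> (gen i) = a \<longleftrightarrow> gen i <#\<^bsub>F_inf\<^esub> N = u <#\<^bsub>F_inf\<^esub> N" for i
      using coset_label_eq_iff[OF D_setD[OF w D] gen_in_carrier u(1)] u(2) by simp
    ultimately show ?thesis by simp
  qed
  have "\<forall>u\<in>carrier F_inf. \<exists>P. finite P \<and> (\<forall>G' \<phi>'. G' \<in> group_operations \<longrightarrow> \<phi>' \<in> hom F_inf (nat_structure G') \<longrightarrow>
      (\<forall>i. \<phi>' (gen i) = ?\<phi> (gen i)) \<longrightarrow> (\<forall>p\<in>P. G' p = G p) \<longrightarrow> \<phi>' u = ?\<phi> u)"
    using hom_value_local[OF G homh] by blast
  from bchoice[OF this] obtain P where P: "\<And>u. u \<in> carrier F_inf \<Longrightarrow> finite (P u)"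
    "\<And>u G' \<phi>'. u \<in> carrier F_inf \<Longrightarrow> G' \<in> group_operations \<Longrightarrow> \<phi>' \<in> hom F_inf (nat_structure G') \<Longrightarrow>
      \<forall>i. \<phi>' (gen i) = ?\<phi> (gen i) \<Longrightarrow> \<forall>p\<in>P u. G' p = G p \<Longrightarrow> \<phi>' u = ?\<phi> u"
    by blast
  \<comment> \<open>The identity word is added so that the identities of \<open>G\<close> and
    \<open>G'\<close> are compared as well.\<close>
  let ?S = "insert \<one>\<^bsub>F_inf\<^esub> S"
  have "G' \<in> coset_operation ` W"
    if G': "G' \<in> group_operations" and eq: "\<forall>p\<in>(\<Union>u\<in>?S. P u). G' p = G p" for G'
  proof -
    have grp: "group (nat_structure G')" using G' by (simp add: group_operations_def)
    have "\<exists>\<phi>'. \<phi>' \<in> hom F_inf (nat_structure G') \<and> (\<forall>i. \<phi>' (gen i) = ?\<phi> (gen i))"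
      by (rule free_group_extend[OF grp]) (simp add: nat_structure_def)
    then obtain \<phi>' where \<phi>': "\<phi>' \<in> hom F_inf (nat_structure G')" "\<forall>i. \<phi>' (gen i) = ?\<phi> (gen i)" by blast
    have agree: "\<phi>' u = ?\<phi> u" if "u \<in> ?S" for u
      using that S eq by (intro P(2)[OF _ G' \<phi>']) auto
    have one: "\<phi>' \<one>\<^bsub>F_inf\<^esub> = \<one>\<^bsub>nat_structure G'\<^esub>"
      using \<phi>'(1) grp F.is_group by (intro group_hom.hom_one) (simp add: group_hom_def group_hom_axioms_def)
    let ?N' = "kernel F_inf (nat_structure G') \<phi>'"
    have N': "?N' \<in> D_set w" "coset_operation ?N' = G'"
      using infinite first_index_coset_label[OF D_setD[OF w D]] \<phi>'(2)
      by (auto intro!: coset_operation_kernel[OF w G' \<phi>'(1)])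
    have "u \<in> ?N' \<longleftrightarrow> u \<in> N" if u: "u \<in> S" for u
    proof -
      \<comment> \<open>Membership in a kernel becomes an equality of two values, and both values
        are shared by \<open>\<phi>'\<close> and \<open>?\<phi>\<close>.\<close>
      have "u \<in> ?N' \<longleftrightarrow> ?\<phi> u = ?\<phi> \<one>\<^bsub>F_inf\<^esub>"
        using S u agree[of u] agree[of "\<one>\<^bsub>F_inf\<^esub>"] one by (auto simp: kernel_def)
      also have "\<dots> \<longleftrightarrow> u \<in> kernel F_inf (nat_structure G) ?\<phi>"
        using S u by (auto simp: kernel_def)
      finally show ?thesis by (simp only: kernel)
    qed
    then have "?N' \<inter> S = N \<inter> S" by blast
    then have "?N' \<in> W" using S N'(1) by blast
    then show ?thesis by (rule rev_image_eqI) (simp add: N'(2))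
  qed
  then show "\<exists>P. finite P \<and> (\<forall>G'\<in>group_operations. (\<forall>p\<in>P. G' p = G p) \<longrightarrow> G' \<in> coset_operation ` W)"
    using S P(1) by (intro exI[of _ "\<Union>u\<in>?S. P u"]) auto
qed

text \<open>One self-numbering \<open>c\<close> with infinite fibres serves every \<open>G\<close>:
  sending \<open>gen i\<close> to \<open>c i\<close> meets the hypotheses of
  \<open>coset_operation_kernel\<close>.\<close>

lemma coset_operation_surj:
  assumes w: "range w = carrier F_inf"
  shows "coset_operation ` D_set w = group_operations"
proof
  show "coset_operation ` D_set w \<subseteq> group_operations"
    by (auto intro!: coset_operation_group D_setD[OF w])
  obtain c :: "nat \<Rightarrow> nat" where c: "\<And>a. infinite {i. c i = a}" "\<And>i. first_index c (c i) = c i"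
    using first_index_numbering_exists by blast
  show "group_operations \<subseteq> coset_operation ` D_set w"
  proof
    fix G assume G: "G \<in> group_operations"
    then have grp: "group (nat_structure G)" by (simp add: group_operations_def)
    have "\<exists>\<phi>. \<phi> \<in> hom F_inf (nat_structure G) \<and> (\<forall>i. \<phi> (gen i) = c i)"
      by (rule free_group_extend[OF grp]) (simp add: nat_structure_def)
    then obtain \<phi> where \<phi>: "\<phi> \<in> hom F_inf (nat_structure G)" "\<And>i. \<phi> (gen i) = c i" by blast
    have "infinite {i. \<phi> (gen i) = a}" "first_index (\<lambda>i. \<phi> (gen i)) (\<phi> (gen i)) = \<phi> (gen i)" for a i
      using c by (simp_all add: \<phi>(2))
    from coset_operation_kernel[OF w G \<phi>(1) this]
    show "G \<in> coset_operation ` D_set w" by (metis image_eqI)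
  qed
qed

text \<open>The enumeration may be any surjection onto the words, repetitions allowed; the witness
  \<open>coset_operation\<close> does not depend on it.\<close>

theorem theorem1p1:
  fixes w :: "nat \<Rightarrow> nat word"
  assumes "range w = carrier F_inf"
  shows "comeager_in marked_groups_topology (D_set w) \<and>
    (\<exists>f :: nat word set \<Rightarrow> (nat \<times> nat \<Rightarrow> nat).
       continuous_map (subtopology marked_groups_topology (D_set w)) group_operations_topology f \<and>
       open_map (subtopology marked_groups_topology (D_set w)) group_operations_topology f \<and>
       f ` D_set w = group_operations \<and>
       (\<forall>N \<in> D_set w. F_inf Mod N \<cong> nat_structure (f N)))"
proof (intro conjI exI[of _ coset_operation] ballI)
  show "F_inf Mod N \<cong> nat_structure (coset_operation N)" if "N \<in> D_set w" for N
    using that by (intro iso_coset_operation D_setD[OF assms])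
qed (rule comeager_D_set[OF assms] continuous_map_coset_operation[OF assms]
    open_map_coset_operation[OF assms] coset_operation_surj[OF assms])+

end
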